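(* Let $U_0\subset\mathbb{R}^n$ be a domain and let $D\subset U_0\times\mathbb{R}^m$ be a strictly convex family of bounded domains over $U_0$. Then the function $$t\mapsto-\ln|D_t|$$ is a strictly convex function on $U_0$, where $|D_t|$ is the Lebesgue measure of $D_t\subset\mathbb{R}^m$.
   Context: Let $p_0:\mathbb{R}^n\times\mathbb{R}^m\to\mathbb{R}^n$ be the natural projection and $D_t=p_0^{-1}(t)\cap D$, regarded as a subset of $\mathbb{R}^m$. A strictly convex family of domains over $U_0$ is a convex domain $D\subset U_0\times\mathbb{R}^m$ with $p_0(D)=U_0$ for which there exists a $C^2$ strictly convex function $\rho_0(t,x)$ on some neighborhood $\tilde D$ of $\overline D$ (closure in $U_0\times\mathbb{R}^m$) such that $D=\{(t,x)\in\tilde D\mid\rho_0(t,x)<0\}$ and, for every $t\in U_0$, the differential of $x\mapsto\rho_0(t,x)$ is nonzero at every point of $\partial D_t$. It is a family of bounded domains if every $D_t$ is bounded. A $C^2$ function is called strictly convex if its Hessian is positive definite everywhere. *)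

theory Defs
  imports "HOL-Analysis.Analysis"
begin

definition is_domain :: "'a::euclidean_space set \<Rightarrow> bool" where
  "is_domain U \<longleftrightarrow> U \<noteq> {} \<and> open U \<and> connected U"

text \<open>Both notions below are meant for open \<open>S\<close>, where the derivatives are unique.\<close>

definition C2_on :: "'a::euclidean_space set \<Rightarrow> ('a \<Rightarrow> real) \<Rightarrow> bool" where
  "C2_on S f \<longleftrightarrow>
    (\<exists>(f' :: 'a \<Rightarrow> 'a \<Rightarrow>\<^sub>L real) (f'' :: 'a \<Rightarrow> 'a \<Rightarrow>\<^sub>L 'a \<Rightarrow>\<^sub>L real).
       (\<forall>x\<in>S. (f has_derivative blinfun_apply (f' x)) (at x)) \<and>
       (\<forall>x\<in>S. (f' has_derivative blinfun_apply (f'' x)) (at x)) \<and>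
       continuous_on S f'')"

text \<open>The Hessian at \<open>x\<close> as a bilinear form: the derivative in direction \<open>u\<close> of the
  directional derivative of \<open>f\<close> along \<open>v\<close>.\<close>

definition hessian :: "('a::euclidean_space \<Rightarrow> real) \<Rightarrow> 'a \<Rightarrow> 'a \<Rightarrow> 'a \<Rightarrow> real" where
  "hessian f x u v = frechet_derivative (\<lambda>y. frechet_derivative f (at y) v) (at x) u"

definition C2_strictly_convex_on :: "'a::euclidean_space set \<Rightarrow> ('a \<Rightarrow> real) \<Rightarrow> bool" where
  "C2_strictly_convex_on S f \<longleftrightarrow>
    C2_on S f \<and> (\<forall>x\<in>S. \<forall>v. v \<noteq> 0 \<longrightarrow> hessian f x v v > 0)"

definition fibre :: "('a \<times> 'b) set \<Rightarrow> 'a \<Rightarrow> 'b set" where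
  "fibre D t = {x. (t, x) \<in> D}"

text \<open>The open set \<open>W\<close> is the neighbourhood of the closure of \<open>D\<close> relative to \<open>U \<times> UNIV\<close>.
  As \<open>U\<close> is open, relatively open and open subsets of \<open>U \<times> UNIV\<close> coincide.\<close>

definition strictly_convex_family ::
  "'a::euclidean_space set \<Rightarrow> ('a \<times> 'b::euclidean_space) set \<Rightarrow> bool" where
  "strictly_convex_family U D \<longleftrightarrow>
    is_domain D \<and> convex D \<and> D \<subseteq> U \<times> UNIV \<and> fst ` D = U \<and>
    (\<exists>W \<rho>. open W \<and> W \<subseteq> U \<times> UNIV \<and> closure D \<inter> (U \<times> UNIV) \<subseteq> W \<and>
       C2_strictly_convex_on W \<rho> \<and>
       D = {p \<in> W. \<rho> p < 0} \<and>
       (\<forall>t\<in>U. \<forall>x\<in>frontier (fibre D t).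
          frechet_derivative (\<lambda>y. \<rho> (t, y)) (at x) \<noteq> (\<lambda>_. 0)))"

end

theory Submission
  imports Defs
begin

text \<open>Write \<open>V(t)\<close> for the volume of the fibre over \<open>t\<close>.

  Regularity: near a given \<open>t\<close> the fibres are star-shaped about a common centre \<open>c\<close>, and their
  radial function is a \<open>C\<^sup>2\<close> function of \<open>t\<close> by implicit differentiation of \<open>\<rho> = 0\<close>. A
  suitable function of the radius, integrated over a fixed box, is a constant multiple of \<open>V\<close>
  (slice by dilates of the fibre), so that \<open>V\<close> is \<open>C\<^sup>2\<close> by differentiation under the integral.

  Strictness: as the Hessian of \<open>\<rho>\<close> is bounded below locally, the midpoint of two points over
  \<open>t \<plusminus> h v\<close> lies in the fibre over \<open>t\<close>, even after dilation by a factor \<open>1 + \<delta> h\<^sup>2\<close>.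
  The midpoint form of the Brunn--Minkowski inequality therefore gives
  \<open>V(t) \<ge> (1 + \<delta> h\<^sup>2) \<surd>(V(t + h v) V(t - h v))\<close>, which bounds the second difference quotient
  of \<open>- ln V\<close> away from zero.\<close>

subsection \<open>The Brunn--Minkowski inequality for midpoints\<close>

text \<open>The "suitable function" of the radius answers two defects: the radius blows up at the
  centre of the fibre, and beyond the fibre it stays positive and merely decays. A function
  \<open>\<Phi>\<close> with derivative \<open>w\<close> supported in [1, 2] is constant for radius
  at least 2, that is near the centre, and for radius at most 1, that is off the fibre. The
  integrand then has a C^2 dependence on t everywhere and vanishes outside the translated fibre. The
  constant multiple is the integral of \<open>w s\<close> / s^m, where m is the dimension of the
  fibre.

  Brunn-Minkowski alone gives only log-concavity of V, and no regularity. The gain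
  \<open>\<delta>\<close> h^2 compares two effects: at the midpoint, \<open>\<rho>\<close> lies
  below - \<kappa> |v|^2 h^2 / 2, where \<kappa> bounds the Hessian from below, while the dilation
  raises \<open>\<rho>\<close> by at most L R \<delta> h^2, where L bounds the derivative and R the
  points of the fibres. A gain of order h^2 is just what a second difference detects, and the
  product form of the inequality becomes such a difference after taking logarithms.\<close>

definition midpoints :: "'a::euclidean_space set \<Rightarrow> 'a set \<Rightarrow> 'a set" where
  "midpoints A B = (\<lambda>(x, y). midpoint x y) ` (A \<times> B)"

lemma midpoints_commute: "midpoints A B = midpoints B A"
  unfolding midpoints_def by (force simp: image_iff midpoint_sym)

lemma midpoints_mono: "A \<subseteq> A' \<Longrightarrow> B \<subseteq> B' \<Longrightarrow> midpoints A B \<subseteq> midpoints A' B'"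
  by (auto simp: midpoints_def)

lemma open_midpoints:
  assumes "open A"
  shows "open (midpoints A B)"
proof -
  have "midpoints A B = (\<Union>y\<in>B. (\<lambda>x. (1/2) *\<^sub>R y + x) ` ((*\<^sub>R) (1/2) ` A))"
    by (auto simp: midpoints_def midpoint_def image_iff algebra_simps)
  also have "open \<dots>"
    using assms by (intro open_UN ballI open_translation open_scaling) auto
  finally show ?thesis .
qed

lemma bounded_midpoints:
  assumes "bounded A" "bounded B"
  shows "bounded (midpoints A B)"
proof -
  have "midpoints A B = (*\<^sub>R) (1/2) ` (\<Union>x\<in>A. \<Union>y\<in>B. {x + y})"
    by (force simp: midpoints_def midpoint_def image_iff)
  then show ?thesis
    using bounded_sums[OF assms] by (simp add: bounded_scaling)
qed

text \<open>A sum of measurable sets can fail to be measurable. Openness of one of the sets avoids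
  the question, which is why boxes below are open.\<close>

lemma lmeasurable_midpoints:
  "open A \<Longrightarrow> bounded A \<Longrightarrow> bounded B \<Longrightarrow> midpoints A B \<in> lmeasurable"
  by (intro lmeasurable_open bounded_midpoints open_midpoints)

lemma measure_midpoints_le:
  assumes "open A" "bounded A" "bounded B" "midpoints A B \<subseteq> S" "S \<in> lmeasurable"
  shows "measure lebesgue (midpoints A B) \<le> measure lebesgue S"
  using assms(4) fmeasurableD[OF lmeasurable_midpoints[OF assms(1-3)]] assms(5)
  by (rule measure_mono_fmeasurable)

section \<open>Cuts by coordinate hyperplanes\<close>

lemma box_Int_lower_halfspace:
  fixes a b i :: "'a::euclidean_space"
  assumes "i \<in> Basis"
  shows "\<exists>c d. box a b \<inter> {x. x \<bullet> i < \<alpha>} = box c d"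
proof -
  have "box a b \<inter> {x. x \<bullet> i < \<alpha>} =
      box a (\<Sum>j\<in>Basis. (if j = i then min (b \<bullet> i) \<alpha> else b \<bullet> j) *\<^sub>R j)"
    using assms by (auto simp: mem_box inner_sum_left_Basis split: if_splits)
  then show ?thesis by blast
qed

lemma box_Int_upper_halfspace:
  fixes a b i :: "'a::euclidean_space"
  assumes "i \<in> Basis"
  shows "\<exists>c d. box a b \<inter> {x. x \<bullet> i > \<alpha>} = box c d"
proof -
  have "box a b \<inter> {x. x \<bullet> i > \<alpha>} =
      box (\<Sum>j\<in>Basis. (if j = i then max (a \<bullet> i) \<alpha> else a \<bullet> j) *\<^sub>R j) b"
    using assms by (auto simp: mem_box inner_sum_left_Basis split: if_splits)
  then show ?thesis by blast
qed

lemma measure_halfspace_split: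
  fixes A :: "'a::euclidean_space set"
  assumes "A \<in> lmeasurable" "i \<in> Basis"
  shows "measure lebesgue A =
    measure lebesgue (A \<inter> {x. x \<bullet> i < \<alpha>}) + measure lebesgue (A \<inter> {x. x \<bullet> i > \<alpha>})"
proof -
  have hs: "A \<inter> {x. x \<bullet> i < \<alpha>} \<in> lmeasurable" "A \<inter> {x. x \<bullet> i > \<alpha>} \<in> lmeasurable"
    using assms open_halfspace_component_lt[of i \<alpha>] open_halfspace_component_gt[of \<alpha> i]
    by (auto intro!: fmeasurable_Int_fmeasurable)
  have n: "negligible {x. x \<bullet> i = \<alpha>}"
    using assms by auto
  have "measure lebesgue A =
      measure lebesgue (A \<inter> {x. x \<bullet> i < \<alpha>} \<union> A \<inter> {x. x \<bullet> i > \<alpha>})"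
    by (rule measure_negligible_symdiff[OF assms(1), symmetric], rule negligible_subset[OF n]) auto
  also have "\<dots> = measure lebesgue (A \<inter> {x. x \<bullet> i < \<alpha>}) + measure lebesgue (A \<inter> {x. x \<bullet> i > \<alpha>})"
    by (rule measure_Un3[OF hs, THEN trans]) (auto simp: Int_def conj_ac cong: conj_cong)
  finally show ?thesis .
qed

text \<open>The volume \<open>F \<beta>\<close> of the part of \<open>B\<close> below level
  \<open>\<beta>\<close> is monotone, and its growth between two levels is at most the content of a
  slab of a bounding box. Thin slabs have small content, so \<open>F\<close> is continuous and the
  intermediate value theorem applies.\<close>

lemma halfspace_bisection:
  fixes B :: "'a::euclidean_space set"
  assumes B: "bounded B" "B \<in> lmeasurable" and i: "i \<in> Basis" and \<theta>: "0 \<le> \<theta>" "\<theta> \<le> 1"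
  shows "\<exists>\<beta>. measure lebesgue (B \<inter> {x. x \<bullet> i < \<beta>}) = \<theta> * measure lebesgue B"
proof -
  define F where "F \<beta> = measure lebesgue (B \<inter> {x. x \<bullet> i < \<beta>})" for \<beta>
  obtain a b where ab: "B \<subseteq> cbox a b"
    using bounded_subset_cbox_symmetric[OF B(1)] by metis
  have lm: "B \<inter> {x. x \<bullet> i < \<beta>} \<in> lmeasurable" for \<beta>
    using B open_halfspace_component_lt[of i \<beta>] by (auto intro!: fmeasurable_Int_fmeasurable)
  have mono: "F x \<le> F y" if "x \<le> y" for x y
    unfolding F_def using that lm by (intro measure_mono_fmeasurable) (auto intro: fmeasurableD)
  have slab: "F y \<le> F x + measure lebesgue (cbox a b \<inter> {z. \<bar>z \<bullet> i - c\<bar> \<le> d})"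
    if "c - d \<le> x" "x \<le> y" "y \<le> c + d" for x y c d
  proof -
    have sl: "cbox a b \<inter> {z. \<bar>z \<bullet> i - c\<bar> \<le> d} \<in> lmeasurable"
      using i by (auto simp: interval_doublesplit)
    have "F y \<le> measure lebesgue (B \<inter> {z. z \<bullet> i < x} \<union> cbox a b \<inter> {z. \<bar>z \<bullet> i - c\<bar> \<le> d})"
      unfolding F_def using lm that ab sl
      by (intro measure_mono_fmeasurable) (auto intro: fmeasurableD simp: abs_le_iff subset_iff)
    also have "\<dots> \<le> F x + measure lebesgue (cbox a b \<inter> {z. \<bar>z \<bullet> i - c\<bar> \<le> d})"
      unfolding F_def using measure_Un_le[of "B \<inter> {z. z \<bullet> i < x}" lebesgue "cbox a b \<inter> {z. \<bar>z \<bullet> i - c\<bar> \<le> d}"] lm sl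
      by (auto intro: fmeasurableD simp: interval_doublesplit[OF i])
    finally show ?thesis .
  qed
  have "isCont F c" for c
    unfolding continuous_at
  proof (rule tendstoI)
    fix e :: real assume "0 < e"
    then obtain d where d: "0 < d" and "measure lborel (cbox a b \<inter> {x. \<bar>x \<bullet> i - c\<bar> \<le> d}) < e"
      by (rule content_doublesplit[OF _ i])
    then have de: "measure lebesgue (cbox a b \<inter> {x. \<bar>x \<bullet> i - c\<bar> \<le> d}) < e"
      by (simp add: interval_doublesplit[OF i])
    have "dist (F x) (F c) < e" if "dist x c < d" for x
    proof (cases "x \<le> c")
      case True
      then show ?thesis
        using d de that slab[of c d x c] mono[of x c] by (simp add: dist_real_def)
    next
      case False
      then show ?thesis
        using d de that slab[of c d c x] mono[of c x] by (simp add: dist_real_def)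
    qed
    then show "\<forall>\<^sub>F x in at c. dist (F x) (F c) < e"
      using d unfolding eventually_at by blast
  qed
  moreover have "F (a \<bullet> i) = 0"
  proof -
    have "B \<inter> {x. x \<bullet> i < a \<bullet> i} = {}"
      using ab i by (force simp: mem_box)
    then show ?thesis by (simp add: F_def)
  qed
  \<comment> \<open>The halfspace is open, so the level has to exceed \<open>b \<bullet> i\<close>
    strictly for all of \<open>B\<close> to lie below it.\<close>
  moreover have "F (b \<bullet> i + 1 + \<bar>a \<bullet> i\<bar>) = measure lebesgue B"
  proof -
    have "B \<inter> {x. x \<bullet> i < b \<bullet> i + 1 + \<bar>a \<bullet> i\<bar>} = B"
      using ab i by (force simp: mem_box)
    then show ?thesis by (simp add: F_def)
  qed
  moreover have "a \<bullet> i \<le> b \<bullet> i + 1 + \<bar>a \<bullet> i\<bar> \<or> B = {}"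
    using ab i by (force simp: mem_box)
  moreover have "0 \<le> \<theta> * measure lebesgue B" "\<theta> * measure lebesgue B \<le> measure lebesgue B"
    using \<theta> by (auto intro: mult_left_le_one_le)
  ultimately show ?thesis
    using IVT[of F "a \<bullet> i" "\<theta> * measure lebesgue B" "b \<bullet> i + 1 + \<bar>a \<bullet> i\<bar>"]
    unfolding F_def by fastforce
qed

text \<open>Disjointness provides a hyperplane that separates two members, and nonemptiness ensures
  that each side of the cut loses a member. The induction on cardinality rests on both.\<close>

definition box_family :: "'a::euclidean_space set set \<Rightarrow> bool" where
  "box_family \<A> \<longleftrightarrow> finite \<A> \<and> disjoint \<A> \<and> (\<forall>P\<in>\<A>. P \<noteq> {} \<and> (\<exists>a b. P = box a b))"

lemma box_familyD:
  assumes "box_family \<A>"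
  shows "open (\<Union>\<A>)" "bounded (\<Union>\<A>)" "\<Union>\<A> \<in> lmeasurable"
proof -
  show "open (\<Union>\<A>)" "bounded (\<Union>\<A>)"
    using assms unfolding box_family_def by (metis open_Union open_box, metis bounded_Union bounded_box)
  then show "\<Union>\<A> \<in> lmeasurable" 
    by (intro lmeasurable_open)
qed

lemma box_family_restrict:
  assumes "box_family \<A>" and H: "\<And>a b. \<exists>c d. box a b \<inter> H = box c d"
  obtains \<B> where "box_family \<B>" "\<Union>\<B> = \<Union>\<A> \<inter> H" "card \<B> \<le> card \<A>"
    "\<And>P. P \<in> \<A> \<Longrightarrow> P \<inter> H = {} \<Longrightarrow> card \<B> < card \<A>"
proof -
  define \<B> where "\<B> = (\<lambda>P. P \<inter> H) ` {P\<in>\<A>. P \<inter> H \<noteq> {}}"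
  have fin: "finite \<A>" using assms by (simp add: box_family_def)
  have "box_family \<B>"
    unfolding box_family_def
  proof (intro conjI)
    show "finite \<B>" using fin by (simp add: \<B>_def)
    show "disjoint \<B>"
      using assms unfolding \<B>_def box_family_def disjoint_def by blast
    show "\<forall>P\<in>\<B>. P \<noteq> {} \<and> (\<exists>a b. P = box a b)"
    proof
      fix P assume "P \<in> \<B>"
      then obtain Q where Q: "Q \<in> \<A>" "P = Q \<inter> H" "P \<noteq> {}" by (auto simp: \<B>_def)
      then obtain a b where "Q = box a b" using assms(1) unfolding box_family_def by blast
      then show "P \<noteq> {} \<and> (\<exists>a b. P = box a b)" using Q H by simp
    qed
  qed
  moreover have "\<Union>\<B> = \<Union>\<A> \<inter> H" by (auto simp: \<B>_def)
  moreover have le: "card \<B> \<le> card {P\<in>\<A>. P \<inter> H \<noteq> {}}"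
    unfolding \<B>_def using fin by (intro card_image_le) auto
  moreover have "card {P\<in>\<A>. P \<inter> H \<noteq> {}} \<le> card \<A>"
    using fin by (intro card_mono) auto
  moreover have "card {P\<in>\<A>. P \<inter> H \<noteq> {}} < card \<A>" if "P \<in> \<A>" "P \<inter> H = {}" for P
    using fin that by (intro psubset_card_mono) auto
  ultimately show thesis
    using that[of \<B>] le_trans[OF le] le_less_trans[OF le] by blast
qed

lemma sqrt_prod: "finite S \<Longrightarrow> sqrt (prod f S) = (\<Prod>i\<in>S. sqrt (f i))"
  by (induction S rule: finite_induct) (auto simp: real_sqrt_mult)

text \<open>The average of two boxes contains a box whose sides are the arithmetic means of the
  given sides. The inequality of arithmetic and geometric means in each coordinate, multiplied over
  all coordinates, gives the claim.\<close>

lemma brunn_minkowski_box: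
  fixes a b c d :: "'a::euclidean_space"
  assumes ne: "box a b \<noteq> {}" "box c d \<noteq> {}"
  shows "sqrt (measure lebesgue (box a b) * measure lebesgue (box c d))
    \<le> measure lebesgue (midpoints (box a b) (box c d))"
proof -
  have ab: "a \<bullet> i < b \<bullet> i" "c \<bullet> i < d \<bullet> i" if "i \<in> Basis" for i
    using ne that by (auto simp: box_ne_empty)
  have sub: "box (midpoint a c) (midpoint b d) \<subseteq> midpoints (box a b) (box c d)"
  proof
    fix z assume z: "z \<in> box (midpoint a c) (midpoint b d)"
    \<comment> \<open>The relative position of \<open>z\<close> along each side of the averaged box.
      The points \<open>x\<close> and \<open>y\<close> with the same relative positions in the two
      boxes have midpoint \<open>z\<close>.\<close>
    define \<theta> where "\<theta> i = (z \<bullet> i - midpoint a c \<bullet> i) / (midpoint b d \<bullet> i - midpoint a c \<bullet> i)" for i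
    have \<theta>: "0 < \<theta> i" "\<theta> i < 1" if "i \<in> Basis" for i
      using z ab[OF that] that by (auto simp: \<theta>_def mem_box midpoint_def inner_simps)
    have z\<theta>: "z \<bullet> i = midpoint a c \<bullet> i + \<theta> i * (midpoint b d \<bullet> i - midpoint a c \<bullet> i)" if "i \<in> Basis" for i
      using ab[OF that] by (auto simp: \<theta>_def midpoint_def inner_simps)
    define x where "x = (\<Sum>i\<in>Basis. (a \<bullet> i + \<theta> i * (b \<bullet> i - a \<bullet> i)) *\<^sub>R i)"
    define y where "y = (\<Sum>i\<in>Basis. (c \<bullet> i + \<theta> i * (d \<bullet> i - c \<bullet> i)) *\<^sub>R i)"
    have lin: "p + t * (q - p) < q" if "p < q" "t < 1" for p q t :: real
    proof -
      have "q - (p + t * (q - p)) = (1 - t) * (q - p)" by algebra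
      also have "\<dots> > 0" using that by simp
      finally show ?thesis by simp
    qed
    have "x \<in> box a b" "y \<in> box c d"
      using \<theta> ab by (auto simp: x_def y_def mem_box intro!: lin)
    moreover have "z = midpoint x y"
      proof (rule euclidean_eqI)
      fix i :: 'a assume i: "i \<in> Basis"
      have "x \<bullet> i = a \<bullet> i + \<theta> i * (b \<bullet> i - a \<bullet> i)" "y \<bullet> i = c \<bullet> i + \<theta> i * (d \<bullet> i - c \<bullet> i)"
        using i by (simp_all add: x_def y_def)
      then show "z \<bullet> i = midpoint x y \<bullet> i"
        by (simp add: z\<theta>[OF i] midpoint_def inner_simps algebra_simps)
    qed
    ultimately show "z \<in> midpoints (box a b) (box c d)"
      by (auto simp: midpoints_def)
  qed
  have "sqrt (measure lebesgue (box a b) * measure lebesgue (box c d)) =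
      (\<Prod>i\<in>Basis. sqrt ((b \<bullet> i - a \<bullet> i) * (d \<bullet> i - c \<bullet> i)))"
    using ab by (simp add: measure_lborel_box_eq less_imp_le inner_diff_left flip: prod.distrib sqrt_prod)
  also have "\<dots> \<le> (\<Prod>i\<in>Basis. ((b \<bullet> i - a \<bullet> i) + (d \<bullet> i - c \<bullet> i)) / 2)"
    using ab by (intro prod_mono conjI arith_geo_mean_sqrt) (auto simp: less_imp_le)
  also have "\<dots> = (\<Prod>i\<in>Basis. (midpoint b d - midpoint a c) \<bullet> i)"
    by (intro prod.cong) (auto simp: midpoint_def inner_simps field_simps)
  also have "\<dots> = measure lebesgue (box (midpoint a c) (midpoint b d))"
    using ab by (auto simp: measure_lborel_box_eq midpoint_def inner_simps less_imp_le add_mono)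
  also have "\<dots> \<le> measure lebesgue (midpoints (box a b) (box c d))"
    using sub by (intro measure_mono_fmeasurable lmeasurable_midpoints) auto
  finally show ?thesis .
qed

text \<open>Disjoint nonempty open boxes already have disjoint projections to some coordinate
  axis.\<close>

lemma box_family_separate:
  assumes "box_family \<A>" "card \<A> \<ge> 2"
  obtains i \<alpha> P Q where "i \<in> Basis" "P \<in> \<A>" "Q \<in> \<A>"
    "P \<subseteq> {x. x \<bullet> i < \<alpha>}" "Q \<subseteq> {x. x \<bullet> i > \<alpha>}"
proof -
  obtain P Q where PQ: "P \<in> \<A>" "Q \<in> \<A>" "P \<noteq> Q"
    using assms(2) by (metis card_le_Suc0_iff_eq card.infinite not_less_eq_eq numeral_2_eq_2 zero_le)
  then obtain a b c d where bx: "P = box a b" "Q = box c d" "P \<noteq> {}" "Q \<noteq> {}" "P \<inter> Q = {}"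
    using assms unfolding box_family_def disjoint_def by meson
  then obtain i where i: "i \<in> Basis" "b \<bullet> i \<le> c \<bullet> i \<or> d \<bullet> i \<le> a \<bullet> i"
    by (force simp: disjoint_interval box_ne_empty)
  show thesis
  proof (cases "b \<bullet> i \<le> c \<bullet> i")
    case True
    then show thesis
      using i PQ bx(1,2) by (intro that[of i P Q "b \<bullet> i"]) (auto simp: mem_box intro: le_less_trans)
  next
    case False
    then show thesis
      using i PQ bx(1,2) by (intro that[of i Q P "d \<bullet> i"]) (auto simp: mem_box intro: le_less_trans)
  qed
qed

text \<open>The cutting argument of Hadwiger and Ohmann: a hyperplane separating two boxes of the first
  family is matched by a parallel hyperplane cutting the second set in the same proportion.\<close>

lemma brunn_minkowski_box_family:
  fixes \<A> \<B> :: "'a::euclidean_space set set"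
  assumes "box_family \<A>" "box_family \<B>"
  shows "sqrt (measure lebesgue (\<Union>\<A>) * measure lebesgue (\<Union>\<B>))
    \<le> measure lebesgue (midpoints (\<Union>\<A>) (\<Union>\<B>))"
  using assms
proof (induction "card \<A> + card \<B>" arbitrary: \<A> \<B> rule: less_induct)
  case less
  \<comment> \<open>Formulated for an arbitrary pair, since the family with at least two boxes may
    be either of the two; the other case follows by symmetry.\<close>
  have step: "sqrt (measure lebesgue (\<Union>\<A>) * measure lebesgue (\<Union>\<B>))
      \<le> measure lebesgue (midpoints (\<Union>\<A>) (\<Union>\<B>))"
    if A: "box_family \<A>" and B: "box_family \<B>" and "card \<A> \<ge> 2"
      and IH: "\<And>\<A>' \<B>' :: 'a set set. card \<A>' + card \<B>' < card \<A> + card \<B> \<Longrightarrow> box_family \<A>' \<Longrightarrow>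
        box_family \<B>' \<Longrightarrow> sqrt (measure lebesgue (\<Union>\<A>') * measure lebesgue (\<Union>\<B>'))
        \<le> measure lebesgue (midpoints (\<Union>\<A>') (\<Union>\<B>'))" for \<A> \<B> :: "'a set set"
  proof -
    obtain i \<alpha> P Q where i: "i \<in> Basis" and PQ: "P \<in> \<A>" "Q \<in> \<A>"
      "P \<subseteq> {x. x \<bullet> i < \<alpha>}" "Q \<subseteq> {x. x \<bullet> i > \<alpha>}"
      using box_family_separate[OF A \<open>card \<A> \<ge> 2\<close>] by metis
    let ?L = "\<lambda>\<alpha>. {x. x \<bullet> i < \<alpha>}" and ?R = "\<lambda>\<alpha>. {x. x \<bullet> i > \<alpha>}"
    let ?m = "measure lebesgue"
    have P: "P \<inter> ?R \<alpha> = {}" and Q: "Q \<inter> ?L \<alpha> = {}"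
      using PQ(3,4) by auto
    obtain \<A>1 where A1: "box_family \<A>1" "\<Union>\<A>1 = \<Union>\<A> \<inter> ?L \<alpha>" "card \<A>1 < card \<A>"
      using box_family_restrict[OF A box_Int_lower_halfspace[OF i], of \<alpha>] \<open>Q \<in> \<A>\<close> Q by metis
    obtain \<A>2 where A2: "box_family \<A>2" "\<Union>\<A>2 = \<Union>\<A> \<inter> ?R \<alpha>" "card \<A>2 < card \<A>"
      using box_family_restrict[OF A box_Int_upper_halfspace[OF i], of \<alpha>] \<open>P \<in> \<A>\<close> P by metis
    have mA: "?m (\<Union>\<A>) = ?m (\<Union>\<A>1) + ?m (\<Union>\<A>2)"
      unfolding A1 A2 by (rule measure_halfspace_split[OF box_familyD(3)[OF A] i])
    \<comment> \<open>The identity for \<open>\<A>1\<close> below would survive a zero denominator: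
      both parts would then have volume zero, and \<open>\<theta>\<close> would be 0 by
      convention.\<close>
    define \<theta> where "\<theta> = ?m (\<Union>\<A>1) / ?m (\<Union>\<A>)"
    have \<theta>: "0 \<le> \<theta>" "\<theta> \<le> 1" and A1\<theta>: "?m (\<Union>\<A>1) = \<theta> * ?m (\<Union>\<A>)" 
    proof -
      have "0 \<le> x / (x + y) \<and> x / (x + y) \<le> 1 \<and> x = x / (x + y) * (x + y)"
        if "0 \<le> x" "0 \<le> y" for x y :: real
        using that by (auto simp: divide_simps)
      from this[of "?m (\<Union>\<A>1)" "?m (\<Union>\<A>2)"]
      show "0 \<le> \<theta>" "\<theta> \<le> 1" "?m (\<Union>\<A>1) = \<theta> * ?m (\<Union>\<A>)"
        unfolding \<theta>_def mA by simp_all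
    qed
    have A2\<theta>: "?m (\<Union>\<A>2) = (1 - \<theta>) * ?m (\<Union>\<A>)"
      using mA A1\<theta> by (simp add: algebra_simps)
    obtain \<beta> where \<beta>: "?m (\<Union>\<B> \<inter> ?L \<beta>) = \<theta> * ?m (\<Union>\<B>)"
      using halfspace_bisection[OF box_familyD(2,3)[OF B] i \<theta>] by blast
    \<comment> \<open>The cut at \<open>\<beta>\<close> is dictated by volume and may cross every
      box of \<open>\<B>\<close>, so only a weak bound on the cardinality is available. The strict
      decrease comes from \<open>\<A>\<close>.\<close>
    obtain \<B>1 where B1: "box_family \<B>1" "\<Union>\<B>1 = \<Union>\<B> \<inter> ?L \<beta>" "card \<B>1 \<le> card \<B>"
      using box_family_restrict[OF B box_Int_lower_halfspace[OF i], of \<beta>] by metis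
    obtain \<B>2 where B2: "box_family \<B>2" "\<Union>\<B>2 = \<Union>\<B> \<inter> ?R \<beta>" "card \<B>2 \<le> card \<B>"
      using box_family_restrict[OF B box_Int_upper_halfspace[OF i], of \<beta>] by metis
    have B2\<theta>: "?m (\<Union>\<B>2) = (1 - \<theta>) * ?m (\<Union>\<B>)"
      using \<beta> measure_halfspace_split[OF box_familyD(3)[OF B] i, of \<beta>] by (simp add: B2 algebra_simps)
    \<comment> \<open>Averages of points below \<open>\<alpha>\<close> and \<open>\<beta>\<close>
      lie below the mean level \<open>?\<gamma>\<close>, and likewise above. The averages of the two
      matching pairs of parts are therefore disjoint, and their volumes add up.\<close>
    let ?M = "midpoints (\<Union>\<A>) (\<Union>\<B>)" and ?\<gamma> = "(\<alpha> + \<beta>) / 2"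
    have M: "?M \<in> lmeasurable"
      using box_familyD[OF A] box_familyD[OF B] by (intro lmeasurable_midpoints) auto
    have lm: "?M \<inter> ?L \<gamma> \<in> lmeasurable" "?M \<inter> ?R \<gamma> \<in> lmeasurable" for \<gamma>
      using M open_halfspace_component_lt[of i \<gamma>] open_halfspace_component_gt[of \<gamma> i]
      by (auto intro!: fmeasurable_Int_fmeasurable)
    have "midpoints (\<Union>\<A>1) (\<Union>\<B>1) \<subseteq> ?M \<inter> ?L ?\<gamma>"
      unfolding A1 B1 by (force simp: midpoints_def midpoint_def inner_simps)
    then have "?m (midpoints (\<Union>\<A>1) (\<Union>\<B>1)) \<le> ?m (?M \<inter> ?L ?\<gamma>)"
      using lm box_familyD[OF A1(1)] box_familyD[OF B1(1)] by (intro measure_midpoints_le)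
    moreover have "card \<A>1 + card \<B>1 < card \<A> + card \<B>"
      using A1(3) B1(3) by linarith
    ultimately have 1: "sqrt (?m (\<Union>\<A>1) * ?m (\<Union>\<B>1)) \<le> ?m (?M \<inter> ?L ?\<gamma>)"
      using IH[OF _ A1(1) B1(1)] by linarith
    have "midpoints (\<Union>\<A>2) (\<Union>\<B>2) \<subseteq> ?M \<inter> ?R ?\<gamma>"
      unfolding A2 B2 by (force simp: midpoints_def midpoint_def inner_simps)
    then have "?m (midpoints (\<Union>\<A>2) (\<Union>\<B>2)) \<le> ?m (?M \<inter> ?R ?\<gamma>)"
      using lm box_familyD[OF A2(1)] box_familyD[OF B2(1)] by (intro measure_midpoints_le)
    moreover have "card \<A>2 + card \<B>2 < card \<A> + card \<B>"
      using A2(3) B2(3) by linarith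
    ultimately have 2: "sqrt (?m (\<Union>\<A>2) * ?m (\<Union>\<B>2)) \<le> ?m (?M \<inter> ?R ?\<gamma>)"
      using IH[OF _ A2(1) B2(1)] by linarith
    let ?s = "sqrt (?m (\<Union>\<A>) * ?m (\<Union>\<B>))"
    have sq: "sqrt (t * x * (t * y)) = t * sqrt (x * y)" if "0 \<le> t" for t x y :: real
    proof -
      have "t * x * (t * y) = t\<^sup>2 * (x * y)" by (simp add: power2_eq_square)
      then show ?thesis using that by (simp add: real_sqrt_mult)
    qed
    \<comment> \<open>Equal proportions on both sides make the two geometric means
      \<open>\<theta> * ?s\<close> and \<open>(1 - \<theta>) * ?s\<close>, so nothing is lost in the
      sum.\<close>
    have "?s = \<theta> * ?s + (1 - \<theta>) * ?s" by algebra
    also have "\<dots> \<le> ?m (?M \<inter> ?L ?\<gamma>) + ?m (?M \<inter> ?R ?\<gamma>)"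
    proof (intro add_mono)
      show "\<theta> * ?s \<le> ?m (?M \<inter> ?L ?\<gamma>)"
        using 1 unfolding A1\<theta> B1(2) \<beta> sq[OF \<theta>(1)] .
      show "(1 - \<theta>) * ?s \<le> ?m (?M \<inter> ?R ?\<gamma>)"
        using 2 \<theta> unfolding A2\<theta> B2\<theta> by (simp add: sq)
    qed
    also have "\<dots> = ?m ?M"
      using measure_halfspace_split[OF M i, of ?\<gamma>] by simp
    finally show ?thesis .
  qed
  consider "card \<A> \<ge> 2" | "card \<B> \<ge> 2" | "card \<A> = 0 \<or> card \<B> = 0" | "card \<A> = 1" "card \<B> = 1"
    by linarith
  then show ?case
  proof cases
    case 1
    then show ?thesis using step[OF less.prems 1] less.hyps by blast
  next
    case 2
    then show ?thesis
      using step[OF less.prems(2,1) 2] less.hyps by (metis add.commute midpoints_commute mult.commute)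
  next
    case 3
    then have "\<A> = {} \<or> \<B> = {}"
      using less.prems by (simp add: box_family_def)
    then show ?thesis by (elim disjE) simp_all
  next
    case 4
    then obtain P Q where "\<A> = {P}" "\<B> = {Q}"
      by (metis card_1_singletonE)
    moreover from this obtain a b c d where "P = box a b" "Q = box c d" "P \<noteq> {}" "Q \<noteq> {}"
      using less.prems by (metis box_family_def singletonI)
    ultimately show ?thesis
      using brunn_minkowski_box by simp
  qed
qed

text \<open>A compact subset of nearly full volume is covered by finitely many boxes whose closures
  lie in \<open>A\<close>. A division of the union of these closures consists of boxes with disjoint
  interiors; passing to the interiors loses only frontiers, which are negligible.\<close>

lemma inner_box_family:
  fixes A :: "'a::euclidean_space set"
  assumes "open A" "bounded A" "0 < e"
  obtains \<A> where "box_family \<A>" "\<Union>\<A> \<subseteq> A" "measure lebesgue A < measure lebesgue (\<Union>\<A>) + e"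
proof -
  have lA: "A \<in> lmeasurable" using assms by (intro lmeasurable_open)
  obtain K where K: "closed K" "K \<subseteq> A" "A - K \<in> lmeasurable" "emeasure lebesgue (A - K) < ennreal e"
    using sets_lebesgue_inner_closed[OF fmeasurableD[OF lA] \<open>0 < e\<close>] by metis
  have cK: "compact K"
    using K assms(2) bounded_subset compact_eq_bounded_closed by blast
  have mK: "measure lebesgue A < measure lebesgue K + e"
  proof -
    have "measure lebesgue (A - K) < e"
      using K(3,4) by (metis emeasure_eq_measure2 ennreal_less_iff measure_nonneg)
    then show ?thesis
      using measurable_measure_Diff[OF lA fmeasurableD[OF lmeasurable_compact[OF cK]] K(2)] by simp
  qed
  have "\<exists>a b. x \<in> box a b \<and> cbox a b \<subseteq> A" if "x \<in> K" for x
    using that K assms open_contains_cbox by (metis subsetD)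
  then obtain a b where ab: "\<And>x. x \<in> K \<Longrightarrow> x \<in> box (a x) (b x) \<and> cbox (a x) (b x) \<subseteq> A"
    by metis
  obtain F where F: "finite F" "F \<subseteq> K" "K \<subseteq> (\<Union>x\<in>F. box (a x) (b x))"
  proof (rule compactE_image[OF cK, of K "\<lambda>x. box (a x) (b x)"])
    show "K \<subseteq> (\<Union>x\<in>K. box (a x) (b x))" using ab by blast
  qed auto
  obtain p where p: "p division_of (\<Union>x\<in>F. cbox (a x) (b x))"
    using elementary_unions_intervals[of "(\<lambda>x. cbox (a x) (b x)) ` F"] F by auto
  \<comment> \<open>Degenerate cells have empty interior and are discarded, because members of a box
    family are nonempty.\<close>
  define \<A> where "\<A> = interior ` p - {{}}"
  have fp: "finite p" using p by blast
  have "box_family \<A>"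
    unfolding box_family_def
  proof (intro conjI)
    show "finite \<A>" using fp by (simp add: \<A>_def)
    show "disjoint \<A>"
      using division_ofD(5)[OF p] unfolding \<A>_def disjoint_def by blast
    show "\<forall>P\<in>\<A>. P \<noteq> {} \<and> (\<exists>a b. P = box a b)"
      using division_ofD(4)[OF p] unfolding \<A>_def by (metis DiffE imageE insertI1 interior_cbox)
  qed
  have Up: "\<Union>p = (\<Union>x\<in>F. cbox (a x) (b x))" using p by blast
  have UA: "\<Union>\<A> = (\<Union>k\<in>p. interior k)" by (auto simp: \<A>_def)
  have "\<Union>\<A> \<subseteq> \<Union>p" unfolding UA using interior_subset by blast
  then have sub: "\<Union>\<A> \<subseteq> A" unfolding Up using ab F by blast
  have neg: "negligible (\<Union>k\<in>p. frontier k)"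
  proof (rule negligible_Union)
    show "negligible X" if "X \<in> frontier ` p" for X
      using that division_ofD(4)[OF p] convex_box(1) negligible_convex_frontier by (metis imageE)
  qed (use fp in auto)
  have "K \<subseteq> \<Union>p" using F(3) Up box_subset_cbox by blast
  also have "\<dots> \<subseteq> \<Union>\<A> \<union> (\<Union>k\<in>p. frontier k)"
    unfolding UA frontier_def using closure_subset by blast
  finally have KU: "K \<subseteq> \<Union>\<A> \<union> (\<Union>k\<in>p. frontier k)" .
  have lmA: "\<Union>\<A> \<in> lmeasurable" by (rule box_familyD(3)[OF \<open>box_family \<A>\<close>])
  have lmN: "(\<Union>k\<in>p. frontier k) \<in> lmeasurable" using neg by (simp add: negligible_imp_measurable)
  have "measure lebesgue K \<le> measure lebesgue (\<Union>\<A> \<union> (\<Union>k\<in>p. frontier k))"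
    using KU lmA lmN cK by (intro measure_mono_fmeasurable) (auto intro: fmeasurableD lmeasurable_compact)
  also have "\<dots> \<le> measure lebesgue (\<Union>\<A>) + measure lebesgue (\<Union>k\<in>p. frontier k)"
    using lmA lmN by (intro measure_Un_le) (auto intro: fmeasurableD)
  also have "measure lebesgue (\<Union>k\<in>p. frontier k) = 0"
    using neg by (rule negligible_imp_measure0)
  finally show thesis using that[OF \<open>box_family \<A>\<close> sub] mK by linarith
qed

theorem brunn_minkowski_midpoints:
  fixes A B :: "'a::euclidean_space set"
  assumes A: "open A" "bounded A" and B: "open B" "bounded B"
  shows "sqrt (measure lebesgue A * measure lebesgue B) \<le> measure lebesgue (midpoints A B)"
proof -
  let ?m = "measure lebesgue" and ?M = "measure lebesgue (midpoints A B)"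
  define e where "e = (\<lambda>n. 1 / real (Suc n))"
  have e: "e n > 0" for n by (simp add: e_def)
  have e0: "e \<longlonglongrightarrow> 0" unfolding e_def by (rule LIMSEQ_Suc[OF lim_1_over_n])
  \<comment> \<open>Truncation at 0 keeps both factors nonnegative; the product of the volumes would
    otherwise not be monotone in them.\<close>
  have bd: "sqrt (max 0 (?m A - e n) * max 0 (?m B - e n)) \<le> ?M" for n
  proof -
    obtain \<A> where \<A>: "box_family \<A>" "\<Union>\<A> \<subseteq> A" "?m A < ?m (\<Union>\<A>) + e n"
      by (rule inner_box_family[OF A e])
    obtain \<B> where \<B>: "box_family \<B>" "\<Union>\<B> \<subseteq> B" "?m B < ?m (\<Union>\<B>) + e n"
      by (rule inner_box_family[OF B e])
    have "sqrt (max 0 (?m A - e n) * max 0 (?m B - e n)) \<le> sqrt (?m (\<Union>\<A>) * ?m (\<Union>\<B>))"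
      using \<A>(3) \<B>(3) by (intro real_sqrt_le_mono mult_mono) auto
    also have "\<dots> \<le> ?m (midpoints (\<Union>\<A>) (\<Union>\<B>))"
      by (rule brunn_minkowski_box_family[OF \<A>(1) \<B>(1)])
    also have "\<dots> \<le> ?M"
      using box_familyD[OF \<A>(1)] box_familyD[OF \<B>(1)] A B \<A>(2) \<B>(2)
      by (intro measure_midpoints_le midpoints_mono lmeasurable_midpoints)
    finally show ?thesis .
  qed
  have "(\<lambda>n. sqrt (max 0 (?m A - e n) * max 0 (?m B - e n))) \<longlonglongrightarrow>
      sqrt (max 0 (?m A - 0) * max 0 (?m B - 0))"
    by (intro tendsto_intros e0)
  then have "sqrt (max 0 (?m A - 0) * max 0 (?m B - 0)) \<le> ?M"
    by (rule LIMSEQ_le_const2) (use bd in auto)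
  then show ?thesis by simp
qed

subsection \<open>Twice continuously differentiable functions\<close>

lemma C2_onE:
  assumes "C2_on S f"
  obtains f' f'' where "\<forall>x\<in>S. (f has_derivative blinfun_apply (f' x)) (at x)"
    "\<forall>x\<in>S. (f' has_derivative blinfun_apply (f'' x)) (at x)" "continuous_on S f''"
  using assms unfolding C2_on_def by blast

text \<open>Connects the Hessian, an iterated directional derivative, with the operator-valued
  second derivative. The inner derivative must be identified on a whole neighbourhood before it is
  differentiated again, hence the open set \<open>S\<close>.\<close>

lemma hessian_eq:
  assumes "open S" "x \<in> S"
    and f': "\<And>x. x \<in> S \<Longrightarrow> (f has_derivative blinfun_apply (f' x)) (at x)"
    and f'': "(f' has_derivative blinfun_apply f'') (at x)"
  shows "hessian f x u v = f'' u v"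
proof -
  have "((\<lambda>y. f' y v) has_derivative (\<lambda>u. f'' u v)) (at x)"
    by (rule derivative_eq_intros f'' refl | simp)+
  then have "((\<lambda>y. frechet_derivative f (at y) v) has_derivative (\<lambda>u. f'' u v)) (at x)"
    by (rule has_derivative_transform_within_open[OF _ assms(1,2)])
       (use f' frechet_derivative_at in metis)
  then show ?thesis
    unfolding hessian_def by (metis frechet_derivative_at)
qed

lemma blinfun_Blinfun_frechet:
  assumes "(f has_derivative blinfun_apply f') (at x)"
  shows "Blinfun (frechet_derivative f (at x)) = f'"
  using frechet_derivative_at[OF assms] by (metis blinfun_apply_inverse)

text \<open>Each neighbourhood comes with derivatives of its own choice. Uniqueness of derivatives
  makes all of them agree with the globally defined \<open>f'\<close> and
  \<open>f''\<close>.\<close>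

lemma C2_on_locally:
  assumes "\<And>x. x \<in> S \<Longrightarrow> \<exists>N. open N \<and> x \<in> N \<and> C2_on N f"
  shows "C2_on S f"
proof -
  define f' where "f' = (\<lambda>x. Blinfun (frechet_derivative f (at x)))"
  define f'' where "f'' = (\<lambda>x. Blinfun (frechet_derivative f' (at x)))"
  have "(f has_derivative f' x) (at x) \<and> (f' has_derivative f'' x) (at x) \<and> isCont f'' x"
    if "x \<in> S" for x
  proof -
    obtain N where N: "open N" "x \<in> N" "C2_on N f" using assms[OF \<open>x \<in> S\<close>] by blast
    obtain g' g'' where g0: "\<forall>x\<in>N. (f has_derivative blinfun_apply (g' x)) (at x)"
      "\<forall>x\<in>N. (g' has_derivative blinfun_apply (g'' x)) (at x)" "continuous_on N g''"
      by (rule C2_onE[OF N(3)])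
    note g = g0[rule_format]
    have f': "f' y = g' y" if "y \<in> N" for y
      unfolding f'_def using g(1)[OF that] by (rule blinfun_Blinfun_frechet)
    have d: "(f' has_derivative g'' y) (at y)" if "y \<in> N" for y
      using has_derivative_transform_within_open[OF g(2)[OF that] N(1) that] f' by simp
    then have f'': "f'' y = g'' y" if "y \<in> N" for y
      unfolding f''_def using that blinfun_Blinfun_frechet by blast
    have "continuous_on N f''"
      using g(3) f'' by (simp cong: continuous_on_cong)
    then have "isCont f'' x"
      using N continuous_on_eq_continuous_at by blast
    then show ?thesis
      using g(1)[OF N(2)] d[OF N(2)] f'[OF N(2)] f''[OF N(2)] by simp
  qed
  then show ?thesis
    unfolding C2_on_def by (metis continuous_at_imp_continuous_on)
qed

lemma C2_on_cong:
  assumes "open S" "\<And>x. x \<in> S \<Longrightarrow> f x = g x" "C2_on S f"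
  shows "C2_on S g"
proof -
  obtain f' f'' where f0: "\<forall>x\<in>S. (f has_derivative blinfun_apply (f' x)) (at x)"
    "\<forall>x\<in>S. (f' has_derivative blinfun_apply (f'' x)) (at x)" "continuous_on S f''"
    using assms(3) by (rule C2_onE)
  note f = f0[rule_format]
  show ?thesis
    unfolding C2_on_def
  proof (intro exI conjI ballI)
    show "continuous_on S f''" by (rule f(3))
    show "(f' has_derivative blinfun_apply (f'' x)) (at x)" if "x \<in> S" for x by (rule f(2)[OF that])
    show "(g has_derivative blinfun_apply (f' x)) (at x)" if "x \<in> S" for x
      by (rule has_derivative_transform_within_open[OF f(1)[OF that] assms(1) that assms(2)])
  qed
qed

lemma C2_on_scale:
  assumes "C2_on S f"
  shows "C2_on S (\<lambda>x. k * f x)"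
proof -
  obtain f' f'' where f0: "\<forall>x\<in>S. (f has_derivative blinfun_apply (f' x)) (at x)"
    "\<forall>x\<in>S. (f' has_derivative blinfun_apply (f'' x)) (at x)" "continuous_on S f''"
    using assms by (rule C2_onE)
  note f = f0[rule_format]
  show ?thesis
    unfolding C2_on_def
  proof (intro exI conjI ballI)
    fix x assume x: "x \<in> S"
    show "((\<lambda>x. k * f x) has_derivative blinfun_apply (k *\<^sub>R f' x)) (at x)"
      using has_derivative_mult_right[OF f(1)[OF x], of k]
      by (rule has_derivative_eq_rhs) (simp add: fun_eq_iff blinfun.scaleR_left)
    show "((\<lambda>x. k *\<^sub>R f' x) has_derivative blinfun_apply (k *\<^sub>R f'' x)) (at x)"
      using has_derivative_scaleR_right[OF f(2)[OF x], of k]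
      by (rule has_derivative_eq_rhs) (simp add: fun_eq_iff blinfun.scaleR_left)
  next
    show "continuous_on S (\<lambda>x. k *\<^sub>R f'' x)"
      using f(3) by (intro continuous_intros)
  qed
qed

lemma C2_on_neg_ln:
  assumes "C2_on S f" and pos: "\<And>x. x \<in> S \<Longrightarrow> f x > 0"
  shows "C2_on S (\<lambda>x. - ln (f x))"
proof -
  obtain f' f'' where f0: "\<forall>x\<in>S. (f has_derivative blinfun_apply (f' x)) (at x)"
    "\<forall>x\<in>S. (f' has_derivative blinfun_apply (f'' x)) (at x)" "continuous_on S f''"
    using assms(1) by (rule C2_onE)
  note f = f0[rule_format]
  have cf: "continuous_on S f" "continuous_on S f'"
    using has_derivative_continuous[OF f(1)] has_derivative_continuous[OF f(2)]
    by (auto intro: continuous_at_imp_continuous_on)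
  have nz: "f x \<noteq> 0" if "x \<in> S" for x using pos[OF that] by simp
  \<comment> \<open>The second derivative of - ln f, namely the form (u, v) -> f'(u) f'(v) / f^2 -
    f''(u, v) / f.\<close>
  define h where "h x = (blinfun_scaleR_left (f' x) o\<^sub>L (inverse ((f x)\<^sup>2) *\<^sub>R f' x)) - inverse (f x) *\<^sub>R f'' x" for x
  show ?thesis
    unfolding C2_on_def
  proof (intro exI conjI ballI)
    fix x assume x: "x \<in> S"
    show "((\<lambda>x. - ln (f x)) has_derivative blinfun_apply (- inverse (f x) *\<^sub>R f' x)) (at x)"
      by (rule derivative_eq_intros f(1)[OF x] pos[OF x] refl)+
         (simp add: fun_eq_iff blinfun.scaleR_left blinfun.minus_left field_simps)
    have "((\<lambda>x. - inverse (f x) *\<^sub>R f' x) has_derivative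
        (\<lambda>u. - inverse (f x) *\<^sub>R f'' x u + (inverse (f x) * f' x u * inverse (f x)) *\<^sub>R f' x)) (at x)"
      by (rule derivative_eq_intros f(1,2)[OF x] nz[OF x] refl)+ simp
    then show "((\<lambda>x. - inverse (f x) *\<^sub>R f' x) has_derivative blinfun_apply (h x)) (at x)"
      by (rule has_derivative_eq_rhs)
         (simp add: h_def fun_eq_iff blinfun.scaleR_left blinfun.diff_left power2_eq_square mult_ac)
  next
    show "continuous_on S h"
      unfolding h_def using cf f(3) nz by (auto intro!: continuous_intros)
  qed
qed

section \<open>Continuously differentiable dependence on a parameter\<close>

text \<open>Differentiability is required in \<open>t\<close> only, with joint continuity of value
  and derivative: just what differentiation under an integral over \<open>x\<close> consumes. The
  derivative is taken in the full space even if \<open>S\<close> is not open, so \<open>S\<close>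
  may be a single slice.\<close>

definition param_C1 :: "('a::real_normed_vector \<times> 'x::t2_space) set \<Rightarrow> ('a \<Rightarrow> 'x \<Rightarrow> 'b::real_normed_vector) \<Rightarrow> bool" where
  "param_C1 S f \<longleftrightarrow> continuous_on S (\<lambda>(t, x). f t x) \<and>
    (\<exists>f' :: 'a \<Rightarrow> 'x \<Rightarrow> 'a \<Rightarrow>\<^sub>L 'b. continuous_on S (\<lambda>(t, x). f' t x) \<and>
      (\<forall>(t, x)\<in>S. ((\<lambda>t. f t x) has_derivative blinfun_apply (f' t x)) (at t)))"

lemma param_C1I:
  assumes "continuous_on S (\<lambda>p. f (fst p) (snd p))" "continuous_on S (\<lambda>p. f' (fst p) (snd p))"
    "\<And>t x. (t, x) \<in> S \<Longrightarrow> ((\<lambda>t. f t x) has_derivative blinfun_apply (f' t x)) (at t)"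
  shows "param_C1 S f"
  using assms unfolding param_C1_def case_prod_unfold by auto

lemma param_C1E:
  assumes "param_C1 S f"
  obtains f' where "continuous_on S (\<lambda>p. f (fst p) (snd p))" "continuous_on S (\<lambda>p. f' (fst p) (snd p))"
    "\<forall>t x. (t, x) \<in> S \<longrightarrow> ((\<lambda>t. f t x) has_derivative blinfun_apply (f' t x)) (at t)"
proof -
  obtain f' :: "'a \<Rightarrow> 'b \<Rightarrow> 'a \<Rightarrow>\<^sub>L 'c" where
    "continuous_on S (\<lambda>(t, x). f' t x)"
    "\<forall>(t, x)\<in>S. ((\<lambda>t. f t x) has_derivative blinfun_apply (f' t x)) (at t)"
    using assms unfolding param_C1_def by blast
  then show thesis
    using assms by (intro that[of f']) (auto simp: param_C1_def case_prod_unfold)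
qed

lemma param_C1_bilinear:
  assumes "bounded_bilinear B" "param_C1 S f" "param_C1 S g"
  shows "param_C1 S (\<lambda>t x. B (f t x) (g t x))"
proof -
  interpret B: bounded_bilinear B by fact
  obtain f' where f0: "continuous_on S (\<lambda>p. f (fst p) (snd p))" "continuous_on S (\<lambda>p. f' (fst p) (snd p))"
    "\<forall>t x. (t, x) \<in> S \<longrightarrow> ((\<lambda>t. f t x) has_derivative blinfun_apply (f' t x)) (at t)"
    using assms(2) by (rule param_C1E)
  note f = f0[rule_format]
  obtain g' where g0: "continuous_on S (\<lambda>p. g (fst p) (snd p))" "continuous_on S (\<lambda>p. g' (fst p) (snd p))"
    "\<forall>t x. (t, x) \<in> S \<longrightarrow> ((\<lambda>t. g t x) has_derivative blinfun_apply (g' t x)) (at t)"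
    using assms(3) by (rule param_C1E)
    note g = g0[rule_format]
  show ?thesis
  proof (rule param_C1I)
    show "continuous_on S (\<lambda>p. B (f (fst p) (snd p)) (g (fst p) (snd p)))"
      by (intro B.continuous_on f g)
    show "continuous_on S (\<lambda>p. (\<lambda>t x. (B.prod_left (g t x) o\<^sub>L f' t x) + (B.prod_right (f t x) o\<^sub>L g' t x)) (fst p) (snd p))"
      by (intro continuous_intros f g bounded_linear.continuous_on[OF B.bounded_linear_prod_left]
          bounded_linear.continuous_on[OF B.bounded_linear_prod_right])
    show "((\<lambda>t. B (f t x) (g t x)) has_derivative
        blinfun_apply ((B.prod_left (g t x) o\<^sub>L f' t x) + (B.prod_right (f t x) o\<^sub>L g' t x))) (at t)"
      if "(t, x) \<in> S" for t x
      using B.FDERIV[OF f(3)[OF that] g(3)[OF that]]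
      by (rule has_derivative_eq_rhs)
         (simp add: fun_eq_iff blinfun.add_left B.prod_left.rep_eq B.prod_right.rep_eq)
  qed
qed

lemma param_C1_compose:
  assumes f: "param_C1 S f" "\<And>t x. (t, x) \<in> S \<Longrightarrow> f t x \<in> Y"
    and \<phi>: "\<And>y. y \<in> Y \<Longrightarrow> (\<phi> has_derivative blinfun_apply (\<phi>' y)) (at y)" "continuous_on Y \<phi>'"
  shows "param_C1 S (\<lambda>t x. \<phi> (f t x))"
proof -
  obtain f' where f'0: "continuous_on S (\<lambda>p. f (fst p) (snd p))" "continuous_on S (\<lambda>p. f' (fst p) (snd p))"
    "\<forall>t x. (t, x) \<in> S \<longrightarrow> ((\<lambda>t. f t x) has_derivative blinfun_apply (f' t x)) (at t)"
    using f(1) by (rule param_C1E)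
    note f' = f'0[rule_format]
  have c\<phi>: "continuous_on Y \<phi>"
    using has_derivative_continuous[OF \<phi>(1)] by (auto intro: continuous_at_imp_continuous_on)
  have im: "(\<lambda>p. f (fst p) (snd p)) ` S \<subseteq> Y"
    using f(2) by auto
  show ?thesis
  proof (rule param_C1I)
    show "continuous_on S (\<lambda>p. \<phi> (f (fst p) (snd p)))"
      using continuous_on_compose2[OF c\<phi> f'(1) im] .
    show "continuous_on S (\<lambda>p. (\<lambda>t x. \<phi>' (f t x) o\<^sub>L f' t x) (fst p) (snd p))"
      by (intro continuous_intros f' continuous_on_compose2[OF \<phi>(2) f'(1) im])
    show "((\<lambda>t. \<phi> (f t x)) has_derivative blinfun_apply (\<phi>' (f t x) o\<^sub>L f' t x)) (at t)"
      if "(t, x) \<in> S" for t x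
      using has_derivative_compose[OF f'(3)[OF that] \<phi>(1)[OF f(2)[OF that]]]
      by (rule has_derivative_eq_rhs) (simp add: fun_eq_iff)
  qed
qed

lemma param_C1_const:
  assumes "continuous_on (snd ` S) g"
  shows "param_C1 S (\<lambda>t x. g x)"
proof (rule param_C1I)
  show "continuous_on S (\<lambda>p. g (snd p))"
    using continuous_on_compose2[OF assms continuous_on_snd[OF continuous_on_id]] by auto
  show "continuous_on S (\<lambda>p. (\<lambda>_ _. 0) (fst p) (snd p))" by simp
qed (simp add: zero_blinfun.rep_eq)

lemma param_C1_add:
  assumes "param_C1 S f" "param_C1 S g"
  shows "param_C1 S (\<lambda>t x. f t x + g t x)"
proof -
  obtain f' where f0: "continuous_on S (\<lambda>p. f (fst p) (snd p))" "continuous_on S (\<lambda>p. f' (fst p) (snd p))"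
    "\<forall>t x. (t, x) \<in> S \<longrightarrow> ((\<lambda>t. f t x) has_derivative blinfun_apply (f' t x)) (at t)"
    using assms(1) by (rule param_C1E)
  note f = f0[rule_format]
  obtain g' where g0: "continuous_on S (\<lambda>p. g (fst p) (snd p))" "continuous_on S (\<lambda>p. g' (fst p) (snd p))"
    "\<forall>t x. (t, x) \<in> S \<longrightarrow> ((\<lambda>t. g t x) has_derivative blinfun_apply (g' t x)) (at t)"
    using assms(2) by (rule param_C1E)
    note g = g0[rule_format]
  show ?thesis
  proof (rule param_C1I)
    show "continuous_on S (\<lambda>p. f (fst p) (snd p) + g (fst p) (snd p))"
      by (intro continuous_intros f g)
    show "continuous_on S (\<lambda>p. (\<lambda>t x. f' t x + g' t x) (fst p) (snd p))"
      by (intro continuous_intros f g)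
    show "((\<lambda>t. f t x + g t x) has_derivative blinfun_apply (f' t x + g' t x)) (at t)"
      if "(t, x) \<in> S" for t x
      using has_derivative_add[OF f(3)[OF that] g(3)[OF that]]
      by (rule has_derivative_eq_rhs) (simp add: fun_eq_iff blinfun.add_left)
  qed
qed

lemma param_C1_locally:
  assumes "\<And>p. p \<in> S \<Longrightarrow> \<exists>N. open N \<and> p \<in> N \<and> param_C1 N f"
  shows "param_C1 S f"
proof -
  define f' where "f' t x = Blinfun (frechet_derivative (\<lambda>t. f t x) (at t))" for t x
  have *: "((\<lambda>t. f t x) has_derivative f' t x) (at t) \<and>
      continuous (at (t, x)) (\<lambda>p. f (fst p) (snd p)) \<and> continuous (at (t, x)) (\<lambda>p. f' (fst p) (snd p))"
    if "(t, x) \<in> S" for t x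
  proof -
    obtain N where N: "open N" "(t, x) \<in> N" "param_C1 N f" using assms[OF \<open>(t, x) \<in> S\<close>] by blast
    obtain g' where g0: "continuous_on N (\<lambda>p. f (fst p) (snd p))" "continuous_on N (\<lambda>p. g' (fst p) (snd p))"
      "\<forall>t x. (t, x) \<in> N \<longrightarrow> ((\<lambda>t. f t x) has_derivative blinfun_apply (g' t x)) (at t)"
      by (rule param_C1E[OF N(3)])
    note g = g0[rule_format]
    have f': "f' s y = g' s y" if "(s, y) \<in> N" for s y
      unfolding f'_def using g(3)[OF that] by (rule blinfun_Blinfun_frechet)
    have "continuous_on N (\<lambda>p. f' (fst p) (snd p))"
      using g(2) f' by (simp cong: continuous_on_cong)
    then have "isCont (\<lambda>p. f (fst p) (snd p)) (t, x)" "isCont (\<lambda>p. f' (fst p) (snd p)) (t, x)"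
      using g(1) N(2) by (simp_all add: continuous_on_eq_continuous_at[OF N(1)])
    then show ?thesis
      using g(3)[OF N(2)] f'[OF N(2)] by simp
  qed
  show ?thesis
    proof (rule param_C1I[where f' = f'])
    show "continuous_on S (\<lambda>p. f (fst p) (snd p))" "continuous_on S (\<lambda>p. f' (fst p) (snd p))"
      using * by (auto intro!: continuous_at_imp_continuous_on)
    show "((\<lambda>t. f t x) has_derivative blinfun_apply (f' t x)) (at t)" if "(t, x) \<in> S" for t x
      using *[OF that] by blast
  qed
qed

lemma param_C1_cong:
  assumes "open S" "\<And>t x. (t, x) \<in> S \<Longrightarrow> f t x = g t x" "param_C1 S f"
  shows "param_C1 S g"
proof -
  obtain f' where f0: "continuous_on S (\<lambda>p. f (fst p) (snd p))" "continuous_on S (\<lambda>p. f' (fst p) (snd p))"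
    "\<forall>t x. (t, x) \<in> S \<longrightarrow> ((\<lambda>t. f t x) has_derivative blinfun_apply (f' t x)) (at t)"
    using assms(3) by (rule param_C1E)
  note f = f0[rule_format]
  show ?thesis
  proof (rule param_C1I[OF _ f(2)])
    show "continuous_on S (\<lambda>p. g (fst p) (snd p))"
      using f(1) assms(2) by (simp cong: continuous_on_cong)
    show "((\<lambda>t. g t x) has_derivative blinfun_apply (f' t x)) (at t)" if "(t, x) \<in> S" for t x
    proof (rule has_derivative_transform_within_open[OF f(3)[OF that]])
      show "open ((\<lambda>t. (t, x)) -` S)"
        using assms(1) by (intro open_vimage continuous_intros)
    qed (use that assms(2) in auto)
  qed
qed

text \<open>The Leibniz rule is applied once to \<open>f\<close> and once to \<open>f'\<close>. The
  domain of integration is a fixed box; the parameter set is convex as that rule demands.\<close>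

lemma C2_on_integral:
  fixes f :: "'a::euclidean_space \<Rightarrow> 'b::euclidean_space \<Rightarrow> real"
  assumes N: "open N" "convex N"
    and f: "continuous_on (N \<times> UNIV) (\<lambda>p. f (fst p) (snd p))"
    and f': "\<And>t x. t \<in> N \<Longrightarrow> ((\<lambda>t. f t x) has_derivative blinfun_apply (f' t x)) (at t)"
    and C1: "param_C1 (N \<times> UNIV) f'"
  shows "C2_on N (\<lambda>t. integral (cbox a b) (f t))"
proof -
  obtain f'' where f''0: "continuous_on (N \<times> UNIV) (\<lambda>p. f' (fst p) (snd p))"
    "continuous_on (N \<times> UNIV) (\<lambda>p. f'' (fst p) (snd p))"
    "\<forall>t x. (t, x) \<in> N \<times> UNIV \<longrightarrow> ((\<lambda>t. f' t x) has_derivative blinfun_apply (f'' t x)) (at t)"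
    using C1 by (rule param_C1E)
    note f'' = f''0[rule_format]
  have sec: "g t integrable_on cbox a b"
    if "continuous_on (N \<times> UNIV) (\<lambda>p. g (fst p) (snd p))" "t \<in> N" for g :: "'a \<Rightarrow> 'b \<Rightarrow> 'c::banach" and t
  proof (rule integrable_continuous)
    have "continuous_on (cbox a b) (\<lambda>x. (t, x))" "(\<lambda>x. (t, x)) ` cbox a b \<subseteq> N \<times> UNIV"
      using that(2) by (auto intro!: continuous_intros)
    from continuous_on_compose2[OF that(1) this] show "continuous_on (cbox a b) (g t)" by simp
  qed
  have sub: "continuous_on (N \<times> cbox a b) (\<lambda>(t, x). g t x)"
    if "continuous_on (N \<times> UNIV) (\<lambda>p. g (fst p) (snd p))" for g :: "'a \<Rightarrow> 'b \<Rightarrow> 'c::banach"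
    using continuous_on_subset[OF that, of "N \<times> cbox a b"] by (auto simp: case_prod_unfold)
  show ?thesis
    unfolding C2_on_def
  proof (intro exI conjI ballI)
    fix t assume t: "t \<in> N"
    have "((\<lambda>t. integral (cbox a b) (f t)) has_derivative integral (cbox a b) (f' t)) (at t within N)"
      using f' has_derivative_at_withinI by (intro leibniz_rule[OF _ sec[OF f] sub[OF f''(1)] t N(2)]) blast
    then show "((\<lambda>t. integral (cbox a b) (f t)) has_derivative integral (cbox a b) (f' t)) (at t)"
      using at_within_open[OF t N(1)] by simp
    have "((\<lambda>t. integral (cbox a b) (f' t)) has_derivative integral (cbox a b) (f'' t)) (at t within N)"
      using f''(3) has_derivative_at_withinI by (intro leibniz_rule[OF _ sec[OF f''(1)] sub[OF f''(2)] t N(2)]) blast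
    then show "((\<lambda>t. integral (cbox a b) (f' t)) has_derivative integral (cbox a b) (f'' t)) (at t)"
      using at_within_open[OF t N(1)] by simp
  next
    show "continuous_on N (\<lambda>t. integral (cbox a b) (f'' t))"
      by (rule integral_continuous_on_param[OF sub[OF f''(2)]])
  qed
qed

text \<open>The solution \<open>s\<close> is given and continuous, so only the derivative of
  \<open>F\<close> at one point matters. Write h and \<sigma> for the increments of t and of s.
  Linearization makes F'(h, 0) + \<sigma> b small relative to |h| + |\<sigma>|. This first yields
  the crude bound |\<sigma>| \<le> C |h|, and inserting that bound yields the derivative.\<close>

lemma implicit_function_derivative:
  fixes F :: "'a::real_normed_vector \<times> real \<Rightarrow> real"
  assumes F: "(F has_derivative F') (at (t0, s t0))"
    and s: "isCont s t0"
    and zero: "\<forall>\<^sub>F t in at t0. F (t, s t) = 0" "F (t0, s t0) = 0"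
    and nz: "F' (0, 1) \<noteq> 0"
  shows "(s has_derivative (\<lambda>h. - F' (h, 0) / F' (0, 1))) (at t0)"
proof -
  interpret F': bounded_linear F' using F by (rule has_derivative_bounded_linear)
  define b where "b = F' (0, 1)"
  obtain K where K: "K > 0" "\<And>p. norm (F' p) \<le> norm p * K"
    using F'.pos_bounded by blast
  have split: "F' (h, \<sigma>) = F' (h, 0) + \<sigma> * b" for h \<sigma>
    using F'.add[of "(h, 0)" "(0, \<sigma>)"] F'.scaleR[of \<sigma> "(0, 1)"] by (simp add: b_def)
  have b: "b \<noteq> 0" using nz by (simp add: b_def)
  \<comment> \<open>From |b| |\<sigma>| \<le> e (|h| + |\<sigma>|) + K |h| with e \<le> |b| / 2: the
    term in |\<sigma>| is absorbed on the left, and solving for |\<sigma>| gives this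
    constant.\<close>
  define C where "C = (2 * K + \<bar>b\<bar>) / \<bar>b\<bar>"
  have C: "C > 0" using b K by (auto simp: C_def intro!: divide_pos_pos add_pos_pos)
  have lim: "((\<lambda>t. (t, s t)) \<longlongrightarrow> (t0, s t0)) (at t0)"
    using s unfolding continuous_at by (intro tendsto_intros)
  have err: "\<forall>\<^sub>F t in at t0. norm (F' (t - t0, s t - s t0)) \<le> e * norm (t - t0, s t - s t0)" if "e > 0" for e
  proof -
    obtain d where d: "d > 0" "\<And>q. norm (q - (t0, s t0)) < d \<Longrightarrow>
        norm (F q - F (t0, s t0) - F' (q - (t0, s t0))) \<le> e * norm (q - (t0, s t0))"
      using F \<open>e > 0\<close> unfolding has_derivative_at_alt by blast
    have "\<forall>\<^sub>F t in at t0. dist (t, s t) (t0, s t0) < d"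
      using lim d(1) by (rule tendstoD)
    then show ?thesis
      using zero(1)
    proof eventually_elim
      case (elim t)
      then show ?case using d(2)[of "(t, s t)"] zero(2) by (simp add: dist_norm)
    qed
  qed
  have bound: "\<bar>s t - s t0 + F' (t - t0, 0) / b\<bar> \<le> e * (1 + C) / \<bar>b\<bar> * norm (t - t0)"
    if e: "norm (F' (t - t0, s t - s t0)) \<le> e * norm (t - t0, s t - s t0)" "0 < e" "e \<le> \<bar>b\<bar> / 2" for t e
  proof -
    let ?h = "t - t0" and ?\<sigma> = "s t - s t0"
    have n: "norm (?h, ?\<sigma>) \<le> norm ?h + \<bar>?\<sigma>\<bar>"
      using norm_Pair_le[of ?h ?\<sigma>] by simp
    have 1: "\<bar>F' (?h, 0) + ?\<sigma> * b\<bar> \<le> e * (norm ?h + \<bar>?\<sigma>\<bar>)"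
    proof -
      have "\<bar>F' (?h, 0) + ?\<sigma> * b\<bar> \<le> e * norm (?h, ?\<sigma>)"
        using e(1) unfolding split[of ?h ?\<sigma>] real_norm_def .
      also have "\<dots> \<le> e * (norm ?h + \<bar>?\<sigma>\<bar>)"
        by (rule mult_left_mono[OF n less_imp_le[OF e(2)]])
      finally show ?thesis .
    qed
    have "\<bar>F' (?h, 0)\<bar> \<le> K * norm ?h"
      using K(2)[of "(?h, 0)"] unfolding norm_Pair2 real_norm_def mult.commute[of K] .
    then have "\<bar>?\<sigma> * b\<bar> \<le> e * (norm ?h + \<bar>?\<sigma>\<bar>) + K * norm ?h"
      using 1 by linarith
    also have "\<dots> \<le> \<bar>b\<bar> / 2 * (norm ?h + \<bar>?\<sigma>\<bar>) + K * norm ?h"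
      using e(3) by (intro add_mono mult_right_mono order_refl add_nonneg_nonneg norm_ge_zero abs_ge_zero)
    finally have "\<bar>b\<bar> * \<bar>?\<sigma>\<bar> \<le> (2 * K + \<bar>b\<bar>) * norm ?h"
      unfolding abs_mult by (simp add: algebra_simps)
    then have 2: "\<bar>?\<sigma>\<bar> \<le> C * norm ?h"
      using b by (simp add: C_def field_simps)
    have "?\<sigma> + F' (?h, 0) / b = (F' (?h, 0) + ?\<sigma> * b) / b"
      using b by (simp add: field_simps)
    then have "\<bar>?\<sigma> + F' (?h, 0) / b\<bar> = \<bar>F' (?h, 0) + ?\<sigma> * b\<bar> / \<bar>b\<bar>"
      by (simp add: abs_divide)
    also have "\<dots> \<le> e * (norm ?h + C * norm ?h) / \<bar>b\<bar>"
      using 1 2 e(2) by (intro divide_right_mono order_trans[OF 1] mult_left_mono) auto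
    finally show ?thesis by (simp add: algebra_simps)
  qed
  have bl: "bounded_linear (\<lambda>h. - F' (h, 0) / F' (0, 1))"
    by (intro bounded_linear_divide[THEN bounded_linear_compose] bounded_linear_minus
        bounded_linear_compose[OF F'.bounded_linear] bounded_linear_Pair bounded_linear_ident bounded_linear_zero)
  show ?thesis
    unfolding has_derivative_within
  proof (intro conjI bl tendstoI)
    fix e :: real assume "e > 0"
    \<comment> \<open>The first entry permits the absorption of |\<sigma>|; the second makes the
      final error at most e / 2 times |h|.\<close>
    define e1 where "e1 = min (\<bar>b\<bar> / 2) (e * \<bar>b\<bar> / (2 * (1 + C)))"
    have e1: "e1 > 0" "e1 \<le> \<bar>b\<bar> / 2"
      using \<open>e > 0\<close> b C by (auto simp: e1_def min_le_iff_disj simp del: le_divide_eq_numeral1)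
    have "e1 * (1 + C) / \<bar>b\<bar> \<le> e * \<bar>b\<bar> / (2 * (1 + C)) * (1 + C) / \<bar>b\<bar>"
      using C by (intro divide_right_mono mult_right_mono) (auto simp: e1_def)
    also have "\<dots> = e / 2"
    proof -
      have "e * \<beta> / (2 * d) * d / \<beta> = e / 2" if "d \<noteq> 0" "\<beta> \<noteq> 0" for d \<beta> :: real
        using that by simp
      from this[of "1 + C" "\<bar>b\<bar>"] show ?thesis using C b by simp
    qed
    also have "\<dots> < e" using \<open>e > 0\<close> by simp
    finally have e2: "e1 * (1 + C) / \<bar>b\<bar> < e" .
    show "\<forall>\<^sub>F t in at t0. dist ((1 / norm (t - t0)) *\<^sub>R (s t - (s t0 + - F' (t - t0, 0) / F' (0, 1)))) 0 < e"
      using err[OF e1(1)] eventually_neq_at_within[of t0 t0 UNIV]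
    proof eventually_elim
      case (elim t)
      then have n: "norm (t - t0) > 0" by simp
      have "\<bar>s t - s t0 + F' (t - t0, 0) / b\<bar> < e * norm (t - t0)"
        using bound[OF elim(1) e1] mult_strict_right_mono[OF e2 n] by linarith
      then have "\<bar>s t - s t0 + F' (t - t0, 0) / b\<bar> / norm (t - t0) < e"
        using n by (simp add: pos_divide_less_eq)
      moreover have "s t - (s t0 + - F' (t - t0, 0) / F' (0, 1)) = s t - s t0 + F' (t - t0, 0) / b"
        by (simp add: b_def)
      ultimately show ?case
        by (simp only:) (simp add: dist_norm abs_divide)
    qed
  qed
qed

subsection \<open>The radial function\<close>

locale strict_family =
  fixes U :: "'a::euclidean_space set" and D W :: "('a \<times> 'b::euclidean_space) set"
    and \<rho> :: "'a \<times> 'b \<Rightarrow> real" and \<rho>' :: "'a \<times> 'b \<Rightarrow> ('a \<times> 'b) \<Rightarrow>\<^sub>L real"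
    and \<rho>'' :: "'a \<times> 'b \<Rightarrow> ('a \<times> 'b) \<Rightarrow>\<^sub>L ('a \<times> 'b) \<Rightarrow>\<^sub>L real"
  assumes open_D: "open D" and convex_D: "convex D" and fst_D: "fst ` D = U"
    and open_W: "open W"
    and closure_D: "\<And>t x. (t, x) \<in> closure D \<Longrightarrow> t \<in> U \<Longrightarrow> (t, x) \<in> W"
    and \<rho>': "\<And>p. p \<in> W \<Longrightarrow> (\<rho> has_derivative blinfun_apply (\<rho>' p)) (at p)"
    and \<rho>'': "\<And>p. p \<in> W \<Longrightarrow> (\<rho>' has_derivative blinfun_apply (\<rho>'' p)) (at p)"
    and cont_\<rho>'': "continuous_on W \<rho>''"
    and hess_pos: "\<And>p v. p \<in> W \<Longrightarrow> v \<noteq> 0 \<Longrightarrow> \<rho>'' p v v > 0"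
    and D_eq: "D = {p \<in> W. \<rho> p < 0}"
    and bounded_fibre: "\<And>t. t \<in> U \<Longrightarrow> bounded (fibre D t)"
begin

lemma open_U: "open U"
  using open_image_fst[OF open_D] fst_D by simp

lemma D_iff: "p \<in> D \<longleftrightarrow> p \<in> W \<and> \<rho> p < 0"
  using D_eq by blast

lemma D_imp_U: "(t, x) \<in> D \<Longrightarrow> t \<in> U"
  using fst_D by force

lemma cont_\<rho>: "continuous_on W \<rho>" and cont_\<rho>': "continuous_on W \<rho>'"
  using has_derivative_continuous[OF \<rho>'] has_derivative_continuous[OF \<rho>'']
  by (auto intro: continuous_at_imp_continuous_on)

lemma open_fibre: "open (fibre D t)"
proof -
  have "fibre D t = (\<lambda>x. (t, x)) -` D" by (auto simp: fibre_def)
  then show ?thesis by (simp add: open_vimage open_D continuous_intros)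
qed

lemma lmeasurable_fibre: "t \<in> U \<Longrightarrow> fibre D t \<in> lmeasurable"
  by (rule lmeasurable_open[OF bounded_fibre open_fibre])

lemma line_derivatives:
  assumes "p + s *\<^sub>R v \<in> W"
  shows "((\<lambda>s. \<rho> (p + s *\<^sub>R v)) has_real_derivative \<rho>' (p + s *\<^sub>R v) v) (at s)"
    and "((\<lambda>s. \<rho>' (p + s *\<^sub>R v) v) has_real_derivative \<rho>'' (p + s *\<^sub>R v) v v) (at s)"
proof -
  have l: "((\<lambda>s. p + s *\<^sub>R v) has_derivative (\<lambda>h. h *\<^sub>R v)) (at s)"
    by (auto intro!: derivative_eq_intros)
  show "((\<lambda>s. \<rho> (p + s *\<^sub>R v)) has_real_derivative \<rho>' (p + s *\<^sub>R v) v) (at s)"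
    unfolding has_field_derivative_def using has_derivative_compose[OF l \<rho>'[OF assms]]
    by (rule has_derivative_eq_rhs) (simp add: fun_eq_iff blinfun.scaleR_right mult.commute)
  have "((\<lambda>s. \<rho>' (p + s *\<^sub>R v)) has_derivative (\<lambda>h. \<rho>'' (p + s *\<^sub>R v) (h *\<^sub>R v))) (at s)"
    using has_derivative_compose[OF l \<rho>''[OF assms]] .
  then have "((\<lambda>s. \<rho>' (p + s *\<^sub>R v) v) has_derivative (\<lambda>h. \<rho>'' (p + s *\<^sub>R v) (h *\<^sub>R v) v)) (at s)"
    by (rule bounded_linear.has_derivative[OF bounded_linear_apply_blinfun])
  then show "((\<lambda>s. \<rho>' (p + s *\<^sub>R v) v) has_real_derivative \<rho>'' (p + s *\<^sub>R v) v v) (at s)"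
    unfolding has_field_derivative_def
    by (rule has_derivative_eq_rhs) (simp add: fun_eq_iff blinfun.scaleR_right blinfun.scaleR_left mult.commute)
qed

end

text \<open>Nothing is assumed about \<open>c\<close>; the condition \<open>(t, c) \<in> D\<close>
  enters through the domain of the radius. As this condition is open in \<open>t\<close>, one centre
  serves all nearby fibres, and \<open>c\<close> does not have to move with
  \<open>t\<close>.\<close>

locale strict_family_centre = strict_family U D W \<rho> \<rho>' \<rho>''
  for U :: "'a::euclidean_space set" and D W :: "('a \<times> 'b::euclidean_space) set" and \<rho> \<rho>' \<rho>'' +
  fixes c :: 'b
begin

text \<open>Meaningless at \<open>x = 0\<close>, where the supremum is over an unbounded set.\<close>

definition rad :: "'a \<Rightarrow> 'b \<Rightarrow> real" where
  "rad t x = Sup {s. 0 < s \<and> (t, c + s *\<^sub>R x) \<in> D}"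

definition ray_domain :: "('a \<times> 'b) set" where
  "ray_domain = {(t, x). (t, c) \<in> D \<and> x \<noteq> 0}"

lemma open_ray_domain: "open ray_domain"
proof -
  have "ray_domain = (\<lambda>p. (fst p, c)) -` D \<inter> snd -` (- {0})"
    by (auto simp: ray_domain_def)
  also have "open \<dots>"
    by (intro open_Int open_vimage open_D continuous_intros)
  finally show ?thesis .
qed

lemma segment_mem:
  assumes "(t, c) \<in> D" "(t, c + s *\<^sub>R x) \<in> closure D" "0 \<le> s'" "s' < s"
  shows "(t, c + s' *\<^sub>R x) \<in> D"
proof -
  have "(t, c + s *\<^sub>R x) - (1 - s' / s) *\<^sub>R ((t, c + s *\<^sub>R x) - (t, c)) \<in> interior D"
    using assms open_D by (intro mem_interior_closure_convex_shrink convex_D) (auto simp: interior_open)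
  also have "(t, c + s *\<^sub>R x) - (1 - s' / s) *\<^sub>R ((t, c + s *\<^sub>R x) - (t, c)) = (t, c + s' *\<^sub>R x)"
    using assms by (simp add: algebra_simps)
  finally show ?thesis
    using open_D by (simp only: interior_open)
qed

lemma ray_extend:
  assumes "(t, c + s *\<^sub>R x) \<in> D"
  shows "\<exists>s'>s. (t, c + s' *\<^sub>R x) \<in> D"
proof -
  have "open ((\<lambda>s. (t, c + s *\<^sub>R x)) -` D)"
    by (intro open_vimage open_D continuous_intros)
  moreover have "s \<in> (\<lambda>s. (t, c + s *\<^sub>R x)) -` D" using assms by simp
  ultimately obtain e where "e > 0" "ball s e \<subseteq> (\<lambda>s. (t, c + s *\<^sub>R x)) -` D"
    unfolding open_contains_ball by blast
  then show ?thesis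
    by (intro exI[of _ "s + e / 2"]) (auto simp: dist_real_def subset_iff)
qed

lemma rad_bdd_above:
  assumes "(t, x) \<in> ray_domain"
  shows "bdd_above {s. 0 < s \<and> (t, c + s *\<^sub>R x) \<in> D}"
proof -
  have "t \<in> U" "x \<noteq> 0" using assms D_imp_U by (auto simp: ray_domain_def)
  then obtain B where B: "\<And>y. y \<in> fibre D t \<Longrightarrow> norm y \<le> B"
    using bounded_fibre unfolding bounded_iff by blast
  show ?thesis
  proof (rule bdd_aboveI)
    fix s assume "s \<in> {s. 0 < s \<and> (t, c + s *\<^sub>R x) \<in> D}"
    then have s: "0 < s" "norm (c + s *\<^sub>R x) \<le> B" using B by (auto simp: fibre_def)
    have "norm (s *\<^sub>R x) \<le> norm (c + s *\<^sub>R x) + norm c"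
      using norm_triangle_ineq4[of "c + s *\<^sub>R x" c] by simp
    then have "s * norm x \<le> B + norm c" using s by simp
    then show "s \<le> (B + norm c) / norm x" using \<open>x \<noteq> 0\<close> by (simp add: field_simps)
  qed
qed

lemma rad_nonempty:
  assumes "(t, x) \<in> ray_domain"
  shows "{s. 0 < s \<and> (t, c + s *\<^sub>R x) \<in> D} \<noteq> {}"
  using ray_extend[of t 0 x] assms by (auto simp: ray_domain_def)

text \<open>Since \<open>D\<close> is open and convex, the admissible \<open>s\<close> form an open
  interval starting at 0. All later arguments use the supremum only through this
  equivalence.\<close>

lemma less_rad_iff:
  assumes "(t, x) \<in> ray_domain" "0 < s"
  shows "s < rad t x \<longleftrightarrow> (t, c + s *\<^sub>R x) \<in> D"
proof
  assume "s < rad t x"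
  then obtain s' where "s < s'" "(t, c + s' *\<^sub>R x) \<in> D"
    unfolding rad_def using less_cSup_iff[OF rad_nonempty rad_bdd_above, OF assms(1,1)] by auto
  then show "(t, c + s *\<^sub>R x) \<in> D"
    using segment_mem[of t s' x s] assms closure_subset by (auto simp: ray_domain_def)
next
  assume "(t, c + s *\<^sub>R x) \<in> D"
  then obtain s' where s': "s < s'" "(t, c + s' *\<^sub>R x) \<in> D" using ray_extend by blast
  then have "s' \<in> {s. 0 < s \<and> (t, c + s *\<^sub>R x) \<in> D}" using assms(2) by simp
  then have "s' \<le> rad t x"
    unfolding rad_def using rad_bdd_above[OF assms(1)] by (rule cSup_upper)
  then show "s < rad t x" using s'(1) by simp
qed

lemma rad_pos:
  assumes "(t, x) \<in> ray_domain"
  shows "0 < rad t x"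
proof -
  obtain s where "0 < s" "(t, c + s *\<^sub>R x) \<in> D" using rad_nonempty[OF assms] by blast
  then show ?thesis using less_rad_iff[OF assms, of s] by simp
qed

lemma rad_not_mem: "(t, x) \<in> ray_domain \<Longrightarrow> (t, c + rad t x *\<^sub>R x) \<notin> D"
  using less_rad_iff rad_pos by blast

lemma rad_closure:
  assumes "(t, x) \<in> ray_domain" "0 \<le> s" "s \<le> rad t x"
  shows "(t, c + s *\<^sub>R x) \<in> closure D"
proof -
  have "closed ((\<lambda>s. (t, c + s *\<^sub>R x)) -` closure D)"
    by (intro closed_vimage closed_closure continuous_intros)
  moreover have "{0<..<rad t x} \<subseteq> (\<lambda>s. (t, c + s *\<^sub>R x)) -` closure D"
    using less_rad_iff[OF assms(1)] subsetD[OF closure_subset] by auto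
  ultimately have "closure {0<..<rad t x} \<subseteq> (\<lambda>s. (t, c + s *\<^sub>R x)) -` closure D"
    by (metis closure_minimal)
  then show ?thesis using rad_pos[OF assms(1)] assms(2,3) by auto
qed

lemma rad_W: "(t, x) \<in> ray_domain \<Longrightarrow> 0 \<le> s \<Longrightarrow> s \<le> rad t x \<Longrightarrow> (t, c + s *\<^sub>R x) \<in> W"
  using rad_closure closure_D D_imp_U by (auto simp: ray_domain_def)

text \<open>The exit point is a limit of points of \<open>D\<close>, which gives one inequality. It
  lies in the closure over \<open>U\<close>, hence in \<open>W\<close>, but not in \<open>D\<close>,
  which gives the other.\<close>

lemma \<rho>_rad:
  assumes "(t, x) \<in> ray_domain"
  shows "\<rho> (t, c + rad t x *\<^sub>R x) = 0"
proof (rule antisym)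
  have cl: "closure {0<..<rad t x} = {0..rad t x}" using rad_pos[OF assms] by simp
  show "\<rho> (t, c + rad t x *\<^sub>R x) \<le> 0"
  proof (rule continuous_le_on_closure[of "{0<..<rad t x}" "\<lambda>s. \<rho> (t, c + s *\<^sub>R x)"])
    show "continuous_on (closure {0<..<rad t x}) (\<lambda>s. \<rho> (t, c + s *\<^sub>R x))"
      unfolding cl by (rule continuous_on_compose2[OF cont_\<rho>])
        (use rad_W[OF assms] in \<open>auto intro!: continuous_intros\<close>)
    show "\<rho> (t, c + s *\<^sub>R x) \<le> 0" if "s \<in> {0<..<rad t x}" for s
      using that less_rad_iff[OF assms] by (auto simp: D_iff less_imp_le)
  qed (use rad_pos[OF assms] in \<open>auto simp: cl\<close>)
  show "0 \<le> \<rho> (t, c + rad t x *\<^sub>R x)"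
    using rad_not_mem[OF assms] rad_W[OF assms] rad_pos[OF assms] by (force simp: D_iff)
qed

text \<open>Along the ray, \<open>\<rho>\<close> rises from a negative value to 0, so its derivative
  is positive somewhere before the exit. The positive second derivative only increases it from there
  on. This is the nondegeneracy needed for implicit differentiation.\<close>

lemma radial_derivative_pos:
  assumes "(t, x) \<in> ray_domain"
  shows "0 < \<rho>' (t, c + rad t x *\<^sub>R x) (0, x)"
proof -
  let ?r = "rad t x" and ?\<gamma> = "\<lambda>s. (t, c) + s *\<^sub>R (0, x)"
  have r: "0 < ?r" by (rule rad_pos[OF assms])
  have W: "?\<gamma> s \<in> W" if "0 \<le> s" "s \<le> ?r" for s
    using rad_W[OF assms that] by simp
  obtain z where z: "0 < z" "z < ?r" "\<rho> (?\<gamma> ?r) - \<rho> (?\<gamma> 0) = (?r - 0) * \<rho>' (?\<gamma> z) (0, x)"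
    using MVT2[OF r, of "\<lambda>s. \<rho> (?\<gamma> s)" "\<lambda>s. \<rho>' (?\<gamma> s) (0, x)"] line_derivatives(1) W by blast
  have "\<rho> (?\<gamma> 0) < 0" using assms by (auto simp: ray_domain_def D_iff)
  moreover have "\<rho> (?\<gamma> ?r) = 0" using \<rho>_rad[OF assms] by simp
  ultimately have "0 < ?r * \<rho>' (?\<gamma> z) (0, x)" using z(3) by simp
  then have pz: "0 < \<rho>' (?\<gamma> z) (0, x)" using r by (simp add: zero_less_mult_iff)
  have d2: "((\<lambda>s. \<rho>' (?\<gamma> s) (0, x)) has_real_derivative \<rho>'' (?\<gamma> s) (0, x) (0, x)) (at s)"
    if "z \<le> s" "s \<le> ?r" for s
    using that z(1) by (intro line_derivatives(2) W) auto
  obtain y where y: "z < y" "y < ?r"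
    "\<rho>' (?\<gamma> ?r) (0, x) - \<rho>' (?\<gamma> z) (0, x) = (?r - z) * \<rho>'' (?\<gamma> y) (0, x) (0, x)"
    using MVT2[OF z(2) d2] by blast
  have "(0, x) \<noteq> (0 :: 'a \<times> 'b)" using assms by (auto simp: ray_domain_def zero_prod_def)
  then have "0 < \<rho>'' (?\<gamma> y) (0, x) (0, x)"
    using hess_pos[OF W] y z(1) by (meson less_imp_le less_trans)
  then have "0 < (?r - z) * \<rho>'' (?\<gamma> y) (0, x) (0, x)" using z(2) by simp
  then show ?thesis using y(3) pz by simp
qed

text \<open>Lower semicontinuity comes from openness of \<open>D\<close>. For the upper half, a
  point strictly beyond the exit point lies outside the closure of \<open>D\<close>, since otherwise
  \<open>segment_mem\<close> would put the exit point into \<open>D\<close>; the complement of the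
  closure is open.\<close>

lemma isCont_rad:
  assumes "(t, x) \<in> ray_domain"
  shows "isCont (\<lambda>p. rad (fst p) (snd p)) (t, x)"
  unfolding continuous_at
proof (rule order_tendstoI)
  fix a assume "a < rad (fst (t, x)) (snd (t, x))"
  then obtain a' where a': "max a 0 < a'" "a' < rad t x"
    using rad_pos[OF assms] dense[of "max a 0" "rad t x"] by auto
  let ?S = "ray_domain \<inter> (\<lambda>p. (fst p, c + a' *\<^sub>R snd p)) -` D"
  have "open ?S" by (intro open_Int open_ray_domain open_vimage open_D continuous_intros)
  moreover have "(t, x) \<in> ?S" using less_rad_iff[OF assms, of a'] a' assms by auto
  moreover have "a < rad (fst p) (snd p)" if "p \<in> ?S" for p
    using that less_rad_iff[of "fst p" "snd p" a'] a' by auto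
  ultimately show "\<forall>\<^sub>F p in at (t, x). a < rad (fst p) (snd p)"
    unfolding eventually_at_topological by blast
next
  fix a assume "rad (fst (t, x)) (snd (t, x)) < a"
  then obtain a' where a': "rad t x < a'" "a' < a"
    using dense by auto
  let ?S = "ray_domain \<inter> (\<lambda>p. (fst p, c + a' *\<^sub>R snd p)) -` (- closure D)"
  have "open ?S" by (intro open_Int open_ray_domain open_vimage open_Compl closed_closure continuous_intros)
  moreover have "(t, x) \<in> ?S"
    using assms segment_mem[of t a' x "rad t x"] a' rad_pos[OF assms] rad_not_mem[OF assms]
    by (auto simp: ray_domain_def)
  moreover have "rad (fst p) (snd p) < a" if "p \<in> ?S" for p
  proof -
    have "(fst p, c + a' *\<^sub>R snd p) \<notin> D" using that closure_subset by auto
    then have "\<not> a' < rad (fst p) (snd p)"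
      using less_rad_iff[of "fst p" "snd p" a'] that a' rad_pos[OF assms] by auto
    then show ?thesis using a' by simp
  qed
  ultimately show "\<forall>\<^sub>F p in at (t, x). rad (fst p) (snd p) < a"
    unfolding eventually_at_topological by blast
qed

lemma continuous_on_rad: "continuous_on ray_domain (\<lambda>p. rad (fst p) (snd p))"
  using isCont_rad by (auto intro!: continuous_at_imp_continuous_on)

definition bnd :: "'a \<Rightarrow> 'b \<Rightarrow> 'a \<times> 'b" where
  "bnd t x = (t, c + rad t x *\<^sub>R x)"

lemma bnd_W: "(t, x) \<in> ray_domain \<Longrightarrow> bnd t x \<in> W"
  using rad_W[of t x "rad t x"] rad_pos[of t x] by (simp add: bnd_def)

lemma continuous_on_bnd: "continuous_on ray_domain (\<lambda>p. bnd (fst p) (snd p))"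
  unfolding bnd_def by (intro continuous_intros continuous_on_rad)

definition \<iota> :: "'a \<Rightarrow>\<^sub>L ('a \<times> 'b)" where
  "\<iota> = Blinfun (\<lambda>h. (h, 0))"

lemma \<iota>_apply [simp]: "blinfun_apply \<iota> h = (h, 0)"
  unfolding \<iota>_def by (simp add: bounded_linear_Blinfun_apply bounded_linear_Pair bounded_linear_ident bounded_linear_zero)

text \<open>Implicit differentiation of \<rho> (t, c + r x) = 0: minus the derivative of
  \<open>\<rho>\<close> along \<open>t\<close>, divided by its derivative along the ray, both at the
  exit point.\<close>

definition drad :: "'a \<Rightarrow> 'b \<Rightarrow> 'a \<Rightarrow>\<^sub>L real" where
  "drad t x = - inverse (\<rho>' (bnd t x) (0, x)) *\<^sub>R (\<rho>' (bnd t x) o\<^sub>L \<iota>)"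

lemma rad_has_derivative:
  assumes "(t, x) \<in> ray_domain"
  shows "((\<lambda>t. rad t x) has_derivative blinfun_apply (drad t x)) (at t)"
proof -
  define F where "F = (\<lambda>q :: 'a \<times> real. \<rho> (fst q, c + snd q *\<^sub>R x))"
  have l: "((\<lambda>q :: 'a \<times> real. (fst q, c + snd q *\<^sub>R x)) has_derivative (\<lambda>q. (fst q, snd q *\<^sub>R x))) (at (t, rad t x))"
    by (auto intro!: derivative_eq_intros)
  have "(\<rho> has_derivative \<rho>' (bnd t x)) (at (fst (t, rad t x), c + snd (t, rad t x) *\<^sub>R x))"
    using \<rho>'[OF bnd_W[OF assms]] by (simp add: bnd_def)
  from has_derivative_compose[OF l this]
  have F: "(F has_derivative (\<lambda>q. \<rho>' (bnd t x) (fst q, snd q *\<^sub>R x))) (at (t, rad t x))"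
    unfolding F_def .
  have "isCont (\<lambda>t. (t, x)) t" by (intro continuous_intros)
  then have cont: "isCont (\<lambda>t. rad t x) t"
    using isCont_o2[of t "\<lambda>t. (t, x)" "\<lambda>p. rad (fst p) (snd p)"] isCont_rad[OF assms] by simp
  have "open ((\<lambda>t. (t, x)) -` ray_domain)"
    by (intro open_vimage open_ray_domain continuous_intros)
  moreover have "t \<in> (\<lambda>t. (t, x)) -` ray_domain" using assms by simp
  moreover have "F (s, rad s x) = 0" if "s \<in> (\<lambda>t. (t, x)) -` ray_domain" for s
    using that \<rho>_rad[of s x] by (simp add: F_def)
  ultimately have ev: "\<forall>\<^sub>F s in at t. F (s, rad s x) = 0"
    unfolding eventually_at_topological by blast
  have z: "F (t, rad t x) = 0" using \<rho>_rad[OF assms] by (simp add: F_def)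
  have nz: "\<rho>' (bnd t x) (fst (0 :: 'a, 1 :: real), snd (0 :: 'a, 1 :: real) *\<^sub>R x) \<noteq> 0"
    using radial_derivative_pos[OF assms] by (simp add: bnd_def)
  show ?thesis
    by (rule has_derivative_eq_rhs[OF implicit_function_derivative[OF F cont ev z nz]])
       (simp add: fun_eq_iff drad_def blinfun.scaleR_left blinfun.minus_left divide_inverse)
qed

lemma continuous_on_\<rho>'_bnd: "continuous_on ray_domain (\<lambda>p. \<rho>' (bnd (fst p) (snd p)))"
  by (rule continuous_on_compose2[OF cont_\<rho>' continuous_on_bnd]) (use bnd_W in auto)

lemma bnd_derivative_ne: "(t, x) \<in> ray_domain \<Longrightarrow> \<rho>' (bnd t x) (0, x) \<noteq> 0"
  using radial_derivative_pos by (metis bnd_def less_irrefl)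

lemma param_C1_rad: "param_C1 ray_domain rad"
proof (rule param_C1I[OF continuous_on_rad])
  show "continuous_on ray_domain (\<lambda>p. drad (fst p) (snd p))"
    unfolding drad_def using bnd_derivative_ne
    by (intro continuous_intros continuous_on_\<rho>'_bnd) auto
qed (rule rad_has_derivative)

text \<open>The formula for \<open>drad\<close> involves only \<open>\<rho>'\<close>, which is C^1,
  and the exit point, which is C^1 in \<open>t\<close> because \<open>rad\<close> is. The radius
  thus gains a second derivative from its own first one.\<close>

lemma param_C1_drad: "param_C1 ray_domain drad"
proof -
  have "param_C1 ray_domain (\<lambda>t x. \<iota> t)"
  proof (rule param_C1I)
    show "continuous_on ray_domain (\<lambda>p. (\<lambda>_ _. \<iota>) (fst p) (snd p))" by simp
    show "((\<lambda>t. \<iota> t) has_derivative blinfun_apply \<iota>) (at t)" for t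
      by (rule bounded_linear_imp_has_derivative[OF blinfun.bounded_linear_right])
  qed (intro continuous_intros)
  moreover have "param_C1 ray_domain (\<lambda>t x. rad t x *\<^sub>R (0 :: 'a, x))"
    by (intro param_C1_bilinear[OF bounded_bilinear_scaleR] param_C1_rad param_C1_const continuous_intros)
  moreover have "param_C1 ray_domain (\<lambda>t x. (0 :: 'a, c))"
    by (intro param_C1_const continuous_intros)
  ultimately have "param_C1 ray_domain (\<lambda>t x. \<iota> t + ((0, c) + rad t x *\<^sub>R (0 :: 'a, x)))"
    by (intro param_C1_add)
  then have bnd: "param_C1 ray_domain bnd"
    by (rule param_C1_cong[OF open_ray_domain, rotated]) (simp add: bnd_def)
  have A: "param_C1 ray_domain (\<lambda>t x. \<rho>' (bnd t x))"
    by (rule param_C1_compose[OF bnd bnd_W \<rho>'' cont_\<rho>''])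
  have p: "param_C1 ray_domain (\<lambda>t x. \<rho>' (bnd t x) o\<^sub>L \<iota>)"
    by (intro param_C1_bilinear[OF bounded_bilinear_blinfun_compose] A param_C1_const continuous_intros)
  have "param_C1 ray_domain (\<lambda>t x. \<rho>' (bnd t x) (0, x))"
    by (intro param_C1_bilinear[OF bounded_bilinear_blinfun_apply] A param_C1_const continuous_intros)
  then have q: "param_C1 ray_domain (\<lambda>t x. - inverse (\<rho>' (bnd t x) (0, x)))"
  proof (rule param_C1_compose[where Y = "- {0}" and \<phi> = "\<lambda>y. - inverse y"])
    show "((\<lambda>y. - inverse y) has_derivative blinfun_apply (blinfun_scaleR_left (inverse (y\<^sup>2)))) (at y)"
      if "y \<in> - {0}" for y :: real
      using that by (auto intro!: derivative_eq_intros simp: power2_eq_square fun_eq_iff)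
    show "continuous_on (- {0}) (\<lambda>y::real. blinfun_scaleR_left (inverse (y\<^sup>2)))"
      by (intro continuous_intros) auto
  qed (use bnd_derivative_ne in auto)
  show ?thesis
    unfolding drad_def by (rule param_C1_bilinear[OF bounded_bilinear_scaleR q p])
qed

end

subsection \<open>Regularity of the volume\<close>

lemma has_real_derivative_max_square:
  "((\<lambda>y. (max 0 y)\<^sup>2) has_real_derivative 2 * max 0 y) (at (y :: real))"
proof -
  consider "y > 0" | "y < 0" | "y = 0" by linarith
  then show ?thesis
  proof cases
    case 1
    have "((\<lambda>y. y\<^sup>2) has_real_derivative 2 * max 0 y) (at y)"
      using 1 by (auto intro!: derivative_eq_intros)
    then show ?thesis
      by (rule has_field_derivative_transform_within_open[where S = "{0<..}"]) (use 1 in auto)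
  next
    case 2
    have "((\<lambda>y. 0) has_real_derivative 2 * max 0 y) (at y)"
      using 2 by (auto intro!: derivative_eq_intros)
    then show ?thesis
      by (rule has_field_derivative_transform_within_open[where S = "{..<0}"]) (use 2 in auto)
  next
    case 3
    have "((\<lambda>h. (max 0 h)\<^sup>2 / h) \<longlongrightarrow> 0) (at (0 :: real))"
    proof (rule Lim_null_comparison)
      have "norm ((max 0 h)\<^sup>2 / h) \<le> \<bar>h\<bar>" for h :: real
        by (cases "h \<le> 0") (auto simp: power2_eq_square)
      then show "\<forall>\<^sub>F h in at (0 :: real). norm ((max 0 h)\<^sup>2 / h) \<le> \<bar>h\<bar>" by simp
      show "((\<lambda>h. \<bar>h\<bar>) \<longlongrightarrow> 0) (at (0 :: real))"
        by (intro tendsto_rabs_zero tendsto_ident_at)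
    qed
    then show ?thesis using 3 by (simp add: has_field_derivative_iff)
  qed
qed

text \<open>The square of the positive part of (s - 1) (2 - s) is C^1 and positive exactly between 1
  and 2. This much smoothness suffices, since only its antiderivative \<open>\<Phi>\<close> has to
  be C^2.\<close>

lemma smooth_cutoff_exists:
  obtains w w' \<Phi> :: "real \<Rightarrow> real" where
    "\<forall>s. (w has_real_derivative w' s) (at s)" "continuous_on UNIV w'"
    "\<forall>s. 0 \<le> w s" "\<forall>s. s \<le> 1 \<or> 2 \<le> s \<longrightarrow> w s = 0" "\<forall>s. 1 < s \<longrightarrow> s < 2 \<longrightarrow> 0 < w s"
    "\<forall>s. (\<Phi> has_real_derivative w s) (at s)"
proof -
  define p :: "real \<Rightarrow> real" where "p s = (s - 1) * (2 - s)" for s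
  define w where "w s = (max 0 (p s))\<^sup>2" for s
  define w' where "w' s = 2 * max 0 (p s) * (3 - 2 * s)" for s
  have p': "(p has_real_derivative 3 - 2 * s) (at s)" for s
    unfolding p_def by (auto intro!: derivative_eq_intros)
  have w': "(w has_real_derivative w' s) (at s)" for s
    using DERIV_chain2[OF has_real_derivative_max_square p'] unfolding w_def w'_def .
  have "isCont w s" for s using w' by (rule DERIV_isCont)
  then obtain \<Phi> where "(\<Phi> has_vector_derivative w s) (at s)" for s
    using einterval_antiderivative[of "-\<infinity>" \<infinity> w] by auto
  then have \<Phi>: "(\<Phi> has_real_derivative w s) (at s)" for s
    by (simp add: has_real_derivative_iff_has_vector_derivative)
  have 1: "w s = 0" if "s \<le> 1 \<or> 2 \<le> s" for s
  proof -
    have "p s \<le> 0"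
      using that unfolding p_def by (auto intro: mult_nonpos_nonneg mult_nonneg_nonpos)
    then show ?thesis by (simp add: w_def)
  qed
  have 2: "0 < w s" if "1 < s" "s < 2" for s
    using that by (auto simp: w_def p_def)
  have 3: "continuous_on UNIV w'"
    unfolding w'_def p_def by (intro continuous_intros)
  have 4: "0 \<le> w s" for s by (simp add: w_def)
  show thesis
    by (rule that[of w w' \<Phi>]) (use w' \<Phi> 1 2 3 4 in auto)
qed

lemma emeasure_dilation_vimage:
  fixes A :: "'a::euclidean_space set"
  assumes "A \<in> sets borel" "0 < s"
  shows "emeasure lborel {x. c + s *\<^sub>R x \<in> A} = ennreal (inverse (s ^ DIM('a))) * emeasure lborel A"
proof -
  let ?S = "{x. c + s *\<^sub>R x \<in> A}"
  have "(\<lambda>x. c + s *\<^sub>R x) \<in> borel_measurable borel" by simp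
  from measurable_sets[OF this assms(1)] have S: "?S \<in> sets borel"
    by (simp add: vimage_def)
  have "A = (\<lambda>x. s *\<^sub>R x + c) ` ?S"
  proof (intro equalityI subsetI)
    fix y assume "y \<in> A"
    then show "y \<in> (\<lambda>x. s *\<^sub>R x + c) ` ?S"
      using assms(2) by (intro image_eqI[of _ _ "(1 / s) *\<^sub>R (y - c)"]) auto
  qed (auto simp: add.commute)
  then have "emeasure lebesgue A = ennreal (s ^ DIM('a)) * emeasure lebesgue ?S"
    using emeasure_lebesgue_affine[of s c ?S] assms(2) by simp
  then have "emeasure lborel A = ennreal (s ^ DIM('a)) * emeasure lborel ?S"
    using S assms(1) by simp
  then show ?thesis
    using assms(2) by (simp add: mult.assoc[symmetric] ennreal_mult[symmetric])
qed

context strict_family_centre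
begin

text \<open>Individual boundedness of the fibres becomes uniform near \<open>t0\<close>: the radius
  is continuous, hence bounded, on the product of a small closed ball and the unit sphere.\<close>

lemma fibre_local_bound:
  assumes "(t0, c) \<in> D"
  obtains e R where "0 < e" "\<And>t. t \<in> cball t0 e \<Longrightarrow> (t, c) \<in> D"
    "\<And>t x. t \<in> cball t0 e \<Longrightarrow> (t, c + x) \<in> D \<Longrightarrow> norm x \<le> R"
proof -
  have "open ((\<lambda>t. (t, c)) -` D)"
    by (intro open_vimage open_D continuous_intros)
  moreover have "t0 \<in> (\<lambda>t. (t, c)) -` D" using assms by simp
  ultimately obtain e where e: "0 < e" "cball t0 e \<subseteq> (\<lambda>t. (t, c)) -` D"
    unfolding open_contains_cball by blast
  have sub: "cball t0 e \<times> sphere 0 1 \<subseteq> ray_domain"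
    using e(2) by (auto simp: ray_domain_def)
  have "compact ((\<lambda>p. rad (fst p) (snd p)) ` (cball t0 e \<times> sphere 0 1))"
    by (intro compact_continuous_image continuous_on_subset[OF continuous_on_rad sub] compact_Times) auto
  then have "bounded ((\<lambda>p. rad (fst p) (snd p)) ` (cball t0 e \<times> sphere 0 1))"
    by (rule compact_imp_bounded)
  then obtain R where R: "\<And>t u. t \<in> cball t0 e \<Longrightarrow> u \<in> sphere 0 1 \<Longrightarrow> \<bar>rad t u\<bar> \<le> R"
    unfolding bounded_iff by fastforce
  show thesis
  proof (rule that[of e "max R 0"])
    fix t x assume t: "t \<in> cball t0 e" and D: "(t, c + x) \<in> D"
    show "norm x \<le> max R 0"
    proof (cases "x = 0")
      case False
      define u where "u = (1 / norm x) *\<^sub>R x"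
      have u: "u \<in> sphere 0 1" "x = norm x *\<^sub>R u" using False by (auto simp: u_def)
      have "(t, u) \<in> ray_domain" using sub t u(1) by blast
      then have "norm x < rad t u" using D u(2) False less_rad_iff[of t u "norm x"] by simp
      then show ?thesis using R[OF t u(1)] by simp
    qed auto
  qed (use e in auto)
qed

section \<open>The profile and its integral\<close>

context
  fixes w w' \<Phi> :: "real \<Rightarrow> real"
  assumes w': "\<And>s. (w has_real_derivative w' s) (at s)" "continuous_on UNIV w'"
    and w_nonneg: "\<And>s. 0 \<le> w s" and w_zero: "\<And>s. s \<le> 1 \<or> 2 \<le> s \<Longrightarrow> w s = 0"
    and w_pos: "\<And>s. 1 < s \<Longrightarrow> s < 2 \<Longrightarrow> 0 < w s"
    and \<Phi>: "\<And>s. (\<Phi> has_real_derivative w s) (at s)"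
begin

text \<open>The radius is infinite at \<open>x = 0\<close>, and \<open>\<Phi>\<close> is constant from \<open>2\<close> on, so that no singularity
  arises there; outside the fibre the radius is at most \<open>1\<close> and the profile vanishes.\<close>

definition profile :: "'a \<Rightarrow> 'b \<Rightarrow> real" where
  "profile t x = (if x = 0 then \<Phi> 2 else \<Phi> (rad t x)) - \<Phi> 0"

definition dprofile :: "'a \<Rightarrow> 'b \<Rightarrow> 'a \<Rightarrow>\<^sub>L real" where
  "dprofile t x = (if x = 0 then 0 else w (rad t x) *\<^sub>R drad t x)"

text \<open>An open set on which the radius is at least 2 for \<open>x \<noteq> 0\<close>, so that
  the profile is constant. It contains the points with \<open>x = 0\<close>, which
  \<open>ray_domain\<close> omits; the two open sets together cover all \<open>(t, x)\<close> with
  \<open>(t, c) \<in> D\<close>.\<close>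

definition inner_domain :: "('a \<times> 'b) set" where
  "inner_domain = {(t, x). (t, c) \<in> D \<and> (t, c + 2 *\<^sub>R x) \<in> D}"

lemma open_inner_domain: "open inner_domain"
proof -
  have "inner_domain = (\<lambda>p. (fst p, c)) -` D \<inter> (\<lambda>p. (fst p, c + 2 *\<^sub>R snd p)) -` D"
    by (auto simp: inner_domain_def)
  also have "open \<dots>"
    by (intro open_Int open_vimage open_D continuous_intros)
  finally show ?thesis .
qed

lemma \<Phi>_mvt: "s < s' \<Longrightarrow> \<exists>z>s. z < s' \<and> \<Phi> s' - \<Phi> s = (s' - s) * w z"
  by (rule MVT2) (use \<Phi> in auto)

lemma \<Phi>_mono:
  assumes "s \<le> s'"
  shows "\<Phi> s \<le> \<Phi> s'"
proof (cases "s = s'")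
  case False
  then obtain z where z: "\<Phi> s' - \<Phi> s = (s' - s) * w z"
    using \<Phi>_mvt[of s s'] assms by auto
  have "0 \<le> (s' - s) * w z" using w_nonneg[of z] assms by simp
  then show ?thesis using z by linarith
qed simp

lemma \<Phi>_const:
  assumes "s \<le> s'" "s' \<le> 1 \<or> 2 \<le> s"
  shows "\<Phi> s' = \<Phi> s"
proof (cases "s = s'")
  case False
  then obtain z where z: "s < z" "z < s'" "\<Phi> s' - \<Phi> s = (s' - s) * w z"
    using \<Phi>_mvt[of s s'] assms(1) by auto
  have "w z = 0" using z assms(2) by (intro w_zero) auto
  then show ?thesis using z(3) by simp
qed simp

lemma \<Phi>_less: "\<Phi> 0 < \<Phi> 2"
proof -
  obtain z where z: "1 < z" "z < 2" "\<Phi> 2 - \<Phi> 1 = (2 - 1) * w z"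
    using \<Phi>_mvt[of 1 2] by auto
  then have "\<Phi> 1 < \<Phi> 2" using w_pos[of z] by simp
  then show ?thesis using \<Phi>_mono[of 0 1] by simp
qed

lemma rad_inner_domain: "(t, x) \<in> inner_domain \<Longrightarrow> x \<noteq> 0 \<Longrightarrow> (t, x) \<in> ray_domain \<and> 2 \<le> rad t x"
  using less_rad_iff[of t x 2] by (auto simp: inner_domain_def ray_domain_def)

lemma profile_inner_domain: "(t, x) \<in> inner_domain \<Longrightarrow> profile t x = \<Phi> 2 - \<Phi> 0"
  using rad_inner_domain \<Phi>_const[of 2 "rad t x"] by (auto simp: profile_def)

lemma dprofile_inner_domain: "(t, x) \<in> inner_domain \<Longrightarrow> dprofile t x = 0"
  using rad_inner_domain w_zero by (auto simp: dprofile_def)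

lemma param_C1_const_fun: "param_C1 S (\<lambda>t x. k)"
  by (intro param_C1_const continuous_intros)

lemma param_C1_glue:
  assumes "param_C1 ray_domain f" "param_C1 inner_domain f" "N \<subseteq> {t. (t, c) \<in> D}"
  shows "param_C1 (N \<times> UNIV) f"
proof (rule param_C1_locally)
  fix p assume "p \<in> N \<times> (UNIV :: 'b set)"
  then have "p \<in> ray_domain \<or> p \<in> inner_domain" using assms(3) by (auto simp: ray_domain_def inner_domain_def)
  then show "\<exists>N. open N \<and> p \<in> N \<and> param_C1 N f"
    using assms open_ray_domain open_inner_domain by blast
qed

lemma has_derivative_blinfun_scaleR_left:
  "(f has_real_derivative y) (at s) \<Longrightarrow> (f has_derivative blinfun_apply (blinfun_scaleR_left y)) (at s)"
  unfolding has_field_derivative_def by (rule has_derivative_eq_rhs) (auto simp: fun_eq_iff)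

lemma param_C1_profile: "N \<subseteq> {t. (t, c) \<in> D} \<Longrightarrow> param_C1 (N \<times> UNIV) profile"
proof (rule param_C1_glue)
  have "param_C1 ray_domain (\<lambda>t x. \<Phi> (rad t x))"
  proof (rule param_C1_compose[OF param_C1_rad, where Y = UNIV])
    show "(\<Phi> has_derivative blinfun_apply (blinfun_scaleR_left (w y))) (at y)" for y
      using \<Phi> by (rule has_derivative_blinfun_scaleR_left)
    have "continuous_on UNIV w" using DERIV_isCont[OF w'(1)] by (auto intro: continuous_at_imp_continuous_on)
    then show "continuous_on UNIV (\<lambda>y. blinfun_scaleR_left (w y))" by (intro continuous_intros)
  qed simp
  then have "param_C1 ray_domain (\<lambda>t x. \<Phi> (rad t x) + - \<Phi> 0)"
    by (intro param_C1_add param_C1_const_fun)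
  then show "param_C1 ray_domain profile"
    by (rule param_C1_cong[OF open_ray_domain, rotated]) (simp add: profile_def ray_domain_def)
  show "param_C1 inner_domain profile"
    by (rule param_C1_cong[OF open_inner_domain _ param_C1_const_fun[where k = "\<Phi> 2 - \<Phi> 0"]]) (simp add: profile_inner_domain)
qed

lemma param_C1_dprofile: "N \<subseteq> {t. (t, c) \<in> D} \<Longrightarrow> param_C1 (N \<times> UNIV) dprofile"
proof (rule param_C1_glue)
  have "param_C1 ray_domain (\<lambda>t x. w (rad t x))"
  proof (rule param_C1_compose[OF param_C1_rad, where Y = UNIV])
    show "(w has_derivative blinfun_apply (blinfun_scaleR_left (w' y))) (at y)" for y
      using w'(1) by (rule has_derivative_blinfun_scaleR_left)
    show "continuous_on UNIV (\<lambda>y. blinfun_scaleR_left (w' y))" 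
      by (rule bounded_linear.continuous_on[OF bounded_linear_blinfun_scaleR_left w'(2)])
  qed simp
  then have "param_C1 ray_domain (\<lambda>t x. w (rad t x) *\<^sub>R drad t x)"
    by (rule param_C1_bilinear[OF bounded_bilinear_scaleR _ param_C1_drad])
  then show "param_C1 ray_domain dprofile"
    by (rule param_C1_cong[OF open_ray_domain, rotated]) (simp add: dprofile_def ray_domain_def)
  show "param_C1 inner_domain dprofile"
    by (rule param_C1_cong[OF open_inner_domain _ param_C1_const_fun[where k = 0]]) (simp add: dprofile_inner_domain)
qed

lemma profile_has_derivative:
  assumes "(t, c) \<in> D"
  shows "((\<lambda>t. profile t x) has_derivative blinfun_apply (dprofile t x)) (at t)"
proof (cases "x = 0")
  case True
  then show ?thesis by (simp add: profile_def dprofile_def zero_blinfun.rep_eq)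
next
  case False
  then have "(t, x) \<in> ray_domain" using assms by (simp add: ray_domain_def)
  from has_derivative_compose[OF rad_has_derivative[OF this] \<Phi>[unfolded has_field_derivative_def]]
  have "((\<lambda>t. \<Phi> (rad t x)) has_derivative (\<lambda>h. w (rad t x) * drad t x h)) (at t)" .
  then have "((\<lambda>t. \<Phi> (rad t x) - \<Phi> 0) has_derivative (\<lambda>h. w (rad t x) * drad t x h - 0)) (at t)"
    by (rule has_derivative_diff) (rule has_derivative_const)
  then have "((\<lambda>t. \<Phi> (rad t x) - \<Phi> 0) has_derivative blinfun_apply (dprofile t x)) (at t)"
    by (rule has_derivative_eq_rhs) (simp add: False dprofile_def fun_eq_iff blinfun.scaleR_left)
  then show ?thesis
    using False by (simp add: profile_def)
qed

lemma C2_on_integral_profile: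
  assumes "open N" "convex N" "N \<subseteq> {t. (t, c) \<in> D}"
  shows "C2_on N (\<lambda>t. integral (cbox a b) (profile t))"
proof (rule C2_on_integral[OF assms(1,2) _ _ param_C1_dprofile[OF assms(3)]])
  show "continuous_on (N \<times> UNIV) (\<lambda>p. profile (fst p) (snd p))"
    using param_C1_profile[OF assms(3)] unfolding param_C1_def case_prod_unfold by blast
  show "((\<lambda>t. profile t x) has_derivative blinfun_apply (dprofile t x)) (at t)" if "t \<in> N" for t x
    using that assms(3) by (intro profile_has_derivative) auto
qed

lemma profile_nonneg: "(t, c) \<in> D \<Longrightarrow> 0 \<le> profile t x"
  using \<Phi>_less \<Phi>_mono[of 0 "rad t x"] rad_pos[of t x] by (auto simp: profile_def ray_domain_def)

lemma profile_zero:
  assumes "(t, c) \<in> D" "(t, c + x) \<notin> D"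
  shows "profile t x = 0"
proof -
  have x: "(t, x) \<in> ray_domain" "x \<noteq> 0" using assms by (auto simp: ray_domain_def)
  then have "rad t x \<le> 1" using less_rad_iff[OF x(1), of 1] assms(2) by simp
  then show ?thesis
    using \<Phi>_const[of 0 "rad t x"] rad_pos[OF x(1)] x(2) by (simp add: profile_def)
qed

lemma nn_integral_w: "0 \<le> b \<Longrightarrow> (\<integral>\<^sup>+s. ennreal (w s) * indicator {0..b} s \<partial>lborel) = ennreal (\<Phi> b - \<Phi> 0)"
  using DERIV_isCont[OF w'(1)] \<Phi> w_nonneg
  by (intro nn_integral_FTC_Icc borel_measurable_continuous_onI)
     (auto intro: continuous_at_imp_continuous_on DERIV_subset)

lemma continuous_on_w: "continuous_on UNIV w"
  using DERIV_isCont[OF w'(1)] by (auto intro: continuous_at_imp_continuous_on)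

lemma borel_w: "w \<in> borel_measurable borel"
  by (rule borel_measurable_continuous_onI[OF continuous_on_w])

text \<open>By the fundamental theorem of calculus the profile is the integral of \<open>w\<close>
  from 0 to the radius, and the admissible \<open>s\<close> fill this interval up to endpoints. For
  \<open>x = 0\<close> every positive \<open>s\<close> is admissible, but \<open>w\<close> vanishes
  from 2 on.\<close>

lemma profile_layers:
  assumes t: "(t, c) \<in> D"
  shows "ennreal (profile t x) = (\<integral>\<^sup>+s. ennreal (w s) * indicator {s. 0 < s \<and> (t, c + s *\<^sub>R x) \<in> D} s \<partial>lborel)"
proof (cases "x = 0")
  case True
  have "ennreal (profile t x) = (\<integral>\<^sup>+s. ennreal (w s) * indicator {0..2} s \<partial>lborel)"
    using True by (simp add: nn_integral_w profile_def)
  also have "\<dots> = (\<integral>\<^sup>+s. ennreal (w s) * indicator {s. 0 < s \<and> (t, c + s *\<^sub>R x) \<in> D} s \<partial>lborel)"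
    using True t w_zero by (intro nn_integral_cong) (auto simp: indicator_def)
  finally show ?thesis .
next
  case False
  then have d: "(t, x) \<in> ray_domain" using t by (simp add: ray_domain_def)
  have "ennreal (profile t x) = (\<integral>\<^sup>+s. ennreal (w s) * indicator {0..rad t x} s \<partial>lborel)"
    using False rad_pos[OF d] by (simp add: nn_integral_w profile_def)
  also have "\<dots> = (\<integral>\<^sup>+s. ennreal (w s) * indicator {s. 0 < s \<and> (t, c + s *\<^sub>R x) \<in> D} s \<partial>lborel)"
  proof (rule nn_integral_cong_AE)
    have "AE s in lborel. s \<noteq> rad t x" by (rule AE_lborel_singleton)
    then show "AE s in lborel. ennreal (w s) * indicator {0..rad t x} s =
        ennreal (w s) * indicator {s. 0 < s \<and> (t, c + s *\<^sub>R x) \<in> D} s"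
    proof eventually_elim
      case (elim s)
      show ?case
        using elim less_rad_iff[OF d, of s] w_zero[of 0] by (cases "s = 0") (auto simp: indicator_def)
    qed
  qed
  finally show ?thesis .
qed

text \<open>The ratio of the integral of the profile to the volume of the fibre. The dilation by 1 /
  s contributes the inverse power, and the ratio does not depend on \<open>t\<close>.\<close>

definition layer_mass :: ennreal where
  "layer_mass = (\<integral>\<^sup>+s. ennreal (w s) * (indicator {0<..} s * ennreal (inverse (s ^ DIM('b)))) \<partial>lborel)"

text \<open>On the support of \<open>w\<close> the inverse power lies between 2^(-m) and 1.
  Positivity and finiteness allow the volume to be recovered by division.\<close>

lemma layer_mass_bounds: "0 < layer_mass" "layer_mass < \<infinity>"
proof -
  have le: "ennreal (inverse (s ^ DIM('b))) \<le> 1" if "1 \<le> s" for s :: real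
    using that by (simp add: inverse_le_1_iff)
  have "layer_mass \<le> (\<integral>\<^sup>+s. ennreal (w s) * indicator {0..2} s \<partial>lborel)"
    unfolding layer_mass_def
  proof (intro nn_integral_mono)
    fix s :: real
    consider "s \<le> 1 \<or> 2 \<le> s" | "1 < s" "s < 2" by linarith
    then show "ennreal (w s) * (indicator {0<..} s * ennreal (inverse (s ^ DIM('b)))) \<le> ennreal (w s) * indicator {0..2} s"
    proof cases
      case 2
      then show ?thesis
        using mult_left_mono[OF le[of s], of "ennreal (w s)"] by simp
    qed (simp add: w_zero)
  qed
  also have "\<dots> < \<infinity>" by (simp add: nn_integral_w)
  finally show "layer_mass < \<infinity>" .
  have "0 < ennreal (inverse (2 ^ DIM('b))) * ennreal (\<Phi> 2 - \<Phi> 0)"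
    using \<Phi>_less by (simp add: ennreal_zero_less_mult_iff)
  also have "\<dots> = (\<integral>\<^sup>+s. ennreal (inverse (2 ^ DIM('b))) * (ennreal (w s) * indicator {0..2} s) \<partial>lborel)"
    using borel_w by (subst nn_integral_cmult) (auto simp: nn_integral_w)
  also have "\<dots> \<le> layer_mass"
    unfolding layer_mass_def
  proof (intro nn_integral_mono)
    fix s :: real
    consider "s \<le> 1 \<or> 2 \<le> s" | "1 < s" "s < 2" by linarith
    then show "ennreal (inverse (2 ^ DIM('b))) * (ennreal (w s) * indicator {0..2} s)
      \<le> ennreal (w s) * (indicator {0<..} s * ennreal (inverse (s ^ DIM('b))))"
    proof cases
      case 2
      then have "s ^ DIM('b) \<le> 2 ^ DIM('b)" by (intro power_mono) auto
      then have "inverse (2 ^ DIM('b)) \<le> inverse (s ^ DIM('b))"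
        using 2 by (intro le_imp_inverse_le) auto
      then have "ennreal (inverse (2 ^ DIM('b))) \<le> ennreal (inverse (s ^ DIM('b)))"
        by (rule ennreal_leI)
      from mult_left_mono[OF this, of "ennreal (w s)"] show ?thesis
        using 2 by (simp add: mult.commute)
    qed (simp add: w_zero)
  qed
  finally show "0 < layer_mass" .
qed

text \<open>Layer cake: the superlevel set \<open>rad t x > s\<close> is the fibre dilated by \<open>1 / s\<close>.\<close>

lemma nn_integral_profile:
  assumes t: "(t, c) \<in> D"
  shows "(\<integral>\<^sup>+x. ennreal (profile t x) \<partial>lborel) = layer_mass * emeasure lborel (fibre D t)"
proof -
  let ?S = "{p. 0 < fst p \<and> (t, c + fst p *\<^sub>R snd p) \<in> D} :: (real \<times> 'b) set"
  have "?S = fst -` {0<..} \<inter> (\<lambda>p. (t, c + fst p *\<^sub>R snd p)) -` D" by auto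
  also have "open \<dots>"
    by (intro open_Int open_vimage open_D open_greaterThan continuous_intros)
  finally have S: "?S \<in> sets borel" by simp
  have m: "(\<lambda>p. ennreal (w (fst p)) * indicator ?S p) \<in> borel_measurable (lborel \<Otimes>\<^sub>M lborel)"
  proof -
    have "(\<lambda>p. ennreal (w (fst p)) * indicator ?S p) \<in> borel_measurable (borel :: (real \<times> 'b) measure)"
    proof (intro borel_measurable_times_ennreal borel_measurable_indicator S)
      have "continuous_on UNIV (\<lambda>p :: real \<times> 'b. w (fst p))"
        by (rule continuous_on_compose2[OF continuous_on_w continuous_on_fst[OF continuous_on_id]]) simp
      then show "(\<lambda>p :: real \<times> 'b. ennreal (w (fst p))) \<in> borel_measurable borel"
        by (intro measurable_compose[OF _ measurable_ennreal] borel_measurable_continuous_onI)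
    qed
    then show ?thesis by (simp add: lborel_prod)
  qed
  have "(\<integral>\<^sup>+x. ennreal (profile t x) \<partial>lborel) =
      (\<integral>\<^sup>+x. \<integral>\<^sup>+s. ennreal (w s) * indicator ?S (s, x) \<partial>lborel \<partial>lborel)"
    unfolding profile_layers[OF t] by (intro nn_integral_cong) (simp add: indicator_def)
  also have "\<dots> = (\<integral>\<^sup>+s. \<integral>\<^sup>+x. ennreal (w s) * indicator ?S (s, x) \<partial>lborel \<partial>lborel)"
    using lborel_pair.Fubini[OF m] by simp
  also have "\<dots> = (\<integral>\<^sup>+s. ennreal (w s) * (indicator {0<..} s * ennreal (inverse (s ^ DIM('b)))) * emeasure lborel (fibre D t) \<partial>lborel)"
  proof (rule nn_integral_cong)
    fix s :: real
    show "(\<integral>\<^sup>+x. ennreal (w s) * indicator ?S (s, x) \<partial>lborel) =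
      ennreal (w s) * (indicator {0<..} s * ennreal (inverse (s ^ DIM('b)))) * emeasure lborel (fibre D t)"
    proof (cases "0 < s")
      case True
      have o: "{x. c + s *\<^sub>R x \<in> fibre D t} \<in> sets borel"
      proof -
        have "{x. c + s *\<^sub>R x \<in> fibre D t} = (\<lambda>x. c + s *\<^sub>R x) -` fibre D t" by auto
        then show ?thesis by (simp add: open_vimage open_fibre continuous_intros borel_open)
      qed
      have "(\<integral>\<^sup>+x. ennreal (w s) * indicator ?S (s, x) \<partial>lborel) =
          (\<integral>\<^sup>+x. ennreal (w s) * indicator {x. c + s *\<^sub>R x \<in> fibre D t} x \<partial>lborel)"
        using True by (intro nn_integral_cong) (auto simp: indicator_def fibre_def)
      also have "\<dots> = ennreal (w s) * emeasure lborel {x. c + s *\<^sub>R x \<in> fibre D t}"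
        using o by (simp add: nn_integral_cmult_indicator)
      finally show ?thesis
        using True open_fibre[of t] by (simp add: emeasure_dilation_vimage mult.assoc)
    qed (simp add: indicator_def)
  qed
  also have "\<dots> = layer_mass * emeasure lborel (fibre D t)"
    unfolding layer_mass_def
  proof (rule nn_integral_multc)
    have "(\<lambda>s :: real. inverse (s ^ DIM('b))) \<in> borel_measurable borel"
      by (intro borel_measurable_inverse borel_measurable_power) simp
    then show "(\<lambda>s. ennreal (w s) * (indicator {0<..} s * ennreal (inverse (s ^ DIM('b))))) \<in> borel_measurable lborel"
      using borel_w
      by (intro borel_measurable_times_ennreal borel_measurable_indicator measurable_compose[OF _ measurable_ennreal]) auto
  qed
  finally show ?thesis .
qed

lemma integral_profile:
  assumes t: "(t, c) \<in> D" and ab: "\<And>x. (t, c + x) \<in> D \<Longrightarrow> x \<in> cbox a b"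
  shows "integral (cbox a b) (profile t) = enn2real layer_mass * measure lebesgue (fibre D t)"
proof -
  have lm: "fibre D t \<in> lmeasurable"
    using t by (intro lmeasurable_fibre D_imp_U)
  have bm: "fibre D t \<in> sets borel"
    using open_fibre by (rule borel_open)
  have "continuous_on ({t} \<times> UNIV) (\<lambda>p. profile (fst p) (snd p))"
    using param_C1_profile[of "{t}"] t unfolding param_C1_def case_prod_unfold by simp
  then have "continuous_on UNIV (\<lambda>x. (\<lambda>p. profile (fst p) (snd p)) (t, x))"
    by (rule continuous_on_compose2) (auto intro!: continuous_intros)
  then have c: "profile t \<in> borel_measurable borel"
    by (simp add: borel_measurable_continuous_onI)
  have "emeasure lborel (fibre D t) = ennreal (measure lebesgue (fibre D t))"
    using emeasure_eq_measure2[OF lm] bm by simp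
  then have "(\<integral>\<^sup>+x. ennreal (profile t x) \<partial>lborel) = ennreal (enn2real layer_mass * measure lebesgue (fibre D t))"
    using layer_mass_bounds nn_integral_profile[OF t] by (simp add: ennreal_mult less_top)
  then have "(profile t has_integral enn2real layer_mass * measure lebesgue (fibre D t)) UNIV"
    using profile_nonneg[OF t] by (intro nn_integral_has_integral[OF c]) auto
  moreover have "profile t = (\<lambda>x. if x \<in> cbox a b then profile t x else 0)"
    using ab profile_zero[OF t] by force
  ultimately have "((\<lambda>x. if x \<in> cbox a b then profile t x else 0) has_integral enn2real layer_mass * measure lebesgue (fibre D t)) UNIV"
    by simp
  then show ?thesis
    by (simp add: has_integral_restrict_UNIV integral_unique)
qed

text \<open>The uniform bound on nearby fibres yields one box containing all the translated fibres.
  The moving domain is thereby replaced by a fixed one, on which the integrand alone depends on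
  \<open>t\<close>.\<close>

lemma C2_measure_fibre_aux:
  assumes "(t0, c) \<in> D"
  shows "\<exists>N. open N \<and> t0 \<in> N \<and> C2_on N (\<lambda>t. measure lebesgue (fibre D t))"
proof -
  obtain e R where e: "0 < e" "\<And>t. t \<in> cball t0 e \<Longrightarrow> (t, c) \<in> D"
    "\<And>t x. t \<in> cball t0 e \<Longrightarrow> (t, c + x) \<in> D \<Longrightarrow> norm x \<le> R"
    using fibre_local_bound[OF assms] by blast
  obtain a :: 'b where a: "cball 0 R \<subseteq> cbox (- a) a"
    using bounded_subset_cbox_symmetric[of "cball 0 R"] by blast
  have D: "ball t0 e \<subseteq> {t. (t, c) \<in> D}" using e(2) by auto
  have "C2_on (ball t0 e) (\<lambda>t. inverse (enn2real layer_mass) * integral (cbox (- a) a) (profile t))"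
    by (intro C2_on_scale C2_on_integral_profile D) auto
  then have "C2_on (ball t0 e) (\<lambda>t. measure lebesgue (fibre D t))"
  proof (rule C2_on_cong[rotated 2])
    fix t assume t: "t \<in> ball t0 e"
    have "integral (cbox (- a) a) (profile t) = enn2real layer_mass * measure lebesgue (fibre D t)"
    proof (rule integral_profile)
      show "x \<in> cbox (- a) a" if "(t, c + x) \<in> D" for x
        using e(3)[OF _ that] t a by auto
    qed (use D t in auto)
    moreover have "enn2real layer_mass \<noteq> 0"
      using layer_mass_bounds by (auto simp: enn2real_eq_0_iff)
    ultimately show "inverse (enn2real layer_mass) * integral (cbox (- a) a) (profile t) = measure lebesgue (fibre D t)"
      by simp
  qed auto
  then show ?thesis using e(1) by (intro exI[of _ "ball t0 e"]) auto
qed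

end

end

context strict_family
begin

lemma C2_measure_fibre: "C2_on U (\<lambda>t. measure lebesgue (fibre D t))"
proof (rule C2_on_locally)
  fix t0 assume "t0 \<in> U"
  then obtain c where c: "(t0, c) \<in> D" using fst_D by force
  interpret strict_family_centre U D W \<rho> \<rho>' \<rho>'' c ..
  obtain w w' \<Phi> :: "real \<Rightarrow> real" where
    "\<forall>s. (w has_real_derivative w' s) (at s)" "continuous_on UNIV w'"
    "\<forall>s. 0 \<le> w s" "\<forall>s. s \<le> 1 \<or> 2 \<le> s \<longrightarrow> w s = 0" "\<forall>s. 1 < s \<longrightarrow> s < 2 \<longrightarrow> 0 < w s"
    "\<forall>s. (\<Phi> has_real_derivative w s) (at s)"
    by (rule smooth_cutoff_exists)
  note w = this[rule_format]
  show "\<exists>N. open N \<and> t0 \<in> N \<and> C2_on N (\<lambda>t. measure lebesgue (fibre D t))"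
    by (rule C2_measure_fibre_aux[OF w c])
qed

end

subsection \<open>Strict convexity\<close>

text \<open>Subtracting \<open>\<delta> * h\<^sup>2\<close> from the symmetric sum gives
  \<open>\<phi>\<close>, with \<phi>'(0) = 0 and \<phi>''(0) = 2 f''(v, v) - 2 \<delta>. Were f''(v,
  v) not positive, \<open>\<phi>\<close> would decrease to the right of 0 and violate the assumed
  bound.\<close>

lemma second_derivative_pos:
  assumes "open N" "t0 \<in> N"
    and f': "\<And>t. t \<in> N \<Longrightarrow> (f has_derivative blinfun_apply (f' t)) (at t)"
    and f'': "(f' has_derivative blinfun_apply f'') (at t0)"
    and "0 < \<delta>" and ev: "\<forall>\<^sub>F h in at_right 0. \<delta> * h\<^sup>2 \<le> f (t0 + h *\<^sub>R v) + f (t0 - h *\<^sub>R v) - 2 * f t0"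
  shows "0 < f'' v v"
proof (rule ccontr)
  assume neg: "\<not> 0 < f'' v v"
  define \<phi> where "\<phi> h = f (t0 + h *\<^sub>R v) + f (t0 - h *\<^sub>R v) - \<delta> * h\<^sup>2" for h
  define \<phi>' where "\<phi>' h = f' (t0 + h *\<^sub>R v) v - f' (t0 - h *\<^sub>R v) v - \<delta> * (2 * h)" for h
  \<comment> \<open>The factor \<open>c\<close> takes the values 1 and -1, so that one computation
    covers both branches.\<close>
  have line: "((\<lambda>h. t0 + h *\<^sub>R (c *\<^sub>R v)) has_derivative (\<lambda>k. k *\<^sub>R (c *\<^sub>R v))) (at h)" for c h :: real
    by (auto intro!: derivative_eq_intros)
  have d1: "((\<lambda>h. f (t0 + h *\<^sub>R (c *\<^sub>R v))) has_real_derivative c * f' (t0 + h *\<^sub>R (c *\<^sub>R v)) v) (at h)"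
    if "t0 + h *\<^sub>R (c *\<^sub>R v) \<in> N" for c h :: real
    unfolding has_field_derivative_def using has_derivative_compose[OF line f'[OF that]]
    by (rule has_derivative_eq_rhs) (simp add: fun_eq_iff blinfun.scaleR_right)
  have d2: "((\<lambda>h. f' (t0 + h *\<^sub>R (c *\<^sub>R v)) v) has_real_derivative c * f'' v v) (at 0)" for c :: real
  proof -
    have "(f' has_derivative blinfun_apply f'') (at (t0 + 0 *\<^sub>R (c *\<^sub>R v)))" using f'' by simp
    from has_derivative_compose[OF line this]
    have "((\<lambda>h. f' (t0 + h *\<^sub>R (c *\<^sub>R v))) has_derivative (\<lambda>k. f'' (k *\<^sub>R (c *\<^sub>R v)))) (at 0)" .
    then have "((\<lambda>h. f' (t0 + h *\<^sub>R (c *\<^sub>R v)) v) has_derivative (\<lambda>k. f'' (k *\<^sub>R (c *\<^sub>R v)) v)) (at 0)"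
      by (rule bounded_linear.has_derivative[OF bounded_linear_apply_blinfun])
    then show ?thesis
      unfolding has_field_derivative_def
      by (rule has_derivative_eq_rhs) (simp add: fun_eq_iff blinfun.scaleR_right blinfun.scaleR_left)
  qed
  have "((\<lambda>h. f' (t0 + h *\<^sub>R (1 *\<^sub>R v)) v - f' (t0 + h *\<^sub>R ((-1) *\<^sub>R v)) v - \<delta> * (2 * h))
      has_real_derivative 1 * f'' v v - (-1) * f'' v v - \<delta> * 2) (at 0)"
    by (intro DERIV_diff d2) (auto intro!: derivative_eq_intros)
  then have "(\<phi>' has_real_derivative 2 * f'' v v - \<delta> * 2) (at 0)"
    by (simp add: \<phi>'_def[abs_def])
  moreover have "2 * f'' v v - \<delta> * 2 < 0" using neg \<open>0 < \<delta>\<close> by linarith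
  ultimately obtain d where d: "0 < d" "\<And>h. 0 < h \<Longrightarrow> h < d \<Longrightarrow> \<phi>' (0 + h) < \<phi>' 0"
    using DERIV_neg_dec_right by blast
  have "open ((\<lambda>h. t0 + h *\<^sub>R v) -` N \<inter> (\<lambda>h. t0 - h *\<^sub>R v) -` N)"
    by (intro open_Int open_vimage assms continuous_intros)
  moreover have "0 \<in> (\<lambda>h. t0 + h *\<^sub>R v) -` N \<inter> (\<lambda>h. t0 - h *\<^sub>R v) -` N"
    using assms(2) by simp
  ultimately obtain e where e: "0 < e"
    "ball 0 e \<subseteq> (\<lambda>h. t0 + h *\<^sub>R v) -` N \<inter> (\<lambda>h. t0 - h *\<^sub>R v) -` N"
    unfolding open_contains_ball by blast
  have \<phi>': "(\<phi> has_real_derivative \<phi>' h) (at h)" if "\<bar>h\<bar> < e" for h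
  proof -
    have N: "t0 + h *\<^sub>R (1 *\<^sub>R v) \<in> N" "t0 + h *\<^sub>R ((-1) *\<^sub>R v) \<in> N"
      using that e(2) by (auto simp: subset_iff)
    have "((\<lambda>h. f (t0 + h *\<^sub>R (1 *\<^sub>R v)) + f (t0 + h *\<^sub>R ((-1) *\<^sub>R v)) - \<delta> * h\<^sup>2) has_real_derivative
        1 * f' (t0 + h *\<^sub>R (1 *\<^sub>R v)) v + (-1) * f' (t0 + h *\<^sub>R ((-1) *\<^sub>R v)) v - \<delta> * (2 * h)) (at h)"
      by (intro DERIV_diff DERIV_add d1 N) (auto intro!: derivative_eq_intros)
    then show ?thesis by (simp add: \<phi>_def[abs_def] \<phi>'_def)
  qed
  have "\<forall>\<^sub>F h in at_right 0. 0 < h \<and> h < min d e"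
    using eventually_at_right_real[of 0 "min d e"] d(1) e(1) by simp
  then have "\<forall>\<^sub>F h in at_right (0 :: real). False"
    using ev
  proof eventually_elim
    case (elim h)
    then obtain z where z: "0 < z" "z < h" "\<phi> h - \<phi> 0 = (h - 0) * \<phi>' z"
      using MVT2[of 0 h \<phi> \<phi>'] \<phi>' by auto
    have "\<phi>' z < 0" using d(2)[of z] z elim by (simp add: \<phi>'_def)
    then have "(h - 0) * \<phi>' z < 0" using elim by (simp add: mult_pos_neg)
    then show False using z(3) elim by (simp add: \<phi>_def)
  qed
  then show False by simp
qed

section \<open>Quantitative room around midpoints\<close>

context strict_family
begin

text \<open>If \<open>y + d\<close> were outside, the ray from \<open>y\<close> would leave
  \<open>D\<close> at some parameter \<open>r\<close> \<le> 1. Up to there it runs inside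
  \<open>D\<close>, where the derivative is at most \<open>L\<close>, so \<open>\<rho>\<close> would
  still be negative at the exit point, where it is 0. The point \<open>y\<close> itself serves as
  centre.\<close>

lemma exit_bound:
  assumes "(t, y) \<in> D" and L: "\<And>x. (t, x) \<in> D \<Longrightarrow> norm (\<rho>' (t, x)) \<le> L"
    and small: "\<rho> (t, y) + L * norm d < 0"
  shows "(t, y + d) \<in> D"
proof (rule ccontr)
  assume nD: "(t, y + d) \<notin> D"
  interpret strict_family_centre U D W \<rho> \<rho>' \<rho>'' y ..
  have ray_domain: "(t, d) \<in> ray_domain" using nD assms(1) by (auto simp: ray_domain_def)
  let ?r = "rad t d" and ?\<gamma> = "\<lambda>s. (t, y) + s *\<^sub>R (0, d)"
  have r: "0 < ?r" "?r \<le> 1" using rad_pos[OF ray_domain] less_rad_iff[OF ray_domain, of 1] nD by auto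
  have W: "?\<gamma> s \<in> W" if "0 \<le> s" "s \<le> ?r" for s using rad_W[OF ray_domain that] by simp
  obtain z where z: "0 < z" "z < ?r" "\<rho> (?\<gamma> ?r) - \<rho> (?\<gamma> 0) = (?r - 0) * \<rho>' (?\<gamma> z) (0, d)"
    using MVT2[OF r(1), of "\<lambda>s. \<rho> (?\<gamma> s)" "\<lambda>s. \<rho>' (?\<gamma> s) (0, d)"] line_derivatives(1) W by blast
  have "(t, y + z *\<^sub>R d) \<in> D" using z less_rad_iff[OF ray_domain] by blast
  then have "norm (\<rho>' (?\<gamma> z)) \<le> L" using L by simp
  then have "\<rho>' (?\<gamma> z) (0, d) \<le> L * norm d"
    using norm_blinfun[of "\<rho>' (?\<gamma> z)" "(0, d)"] mult_right_mono[of "norm (\<rho>' (?\<gamma> z))" L "norm d"] by simp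
  then have "?r * \<rho>' (?\<gamma> z) (0, d) \<le> ?r * (L * norm d)"
    using r by (intro mult_left_mono) auto
  also have "\<dots> \<le> 1 * (L * norm d)"
    using r order_trans[OF norm_ge_zero L[OF assms(1)]] by (intro mult_right_mono mult_nonneg_nonneg) auto
  finally have "\<rho> (?\<gamma> ?r) - \<rho> (?\<gamma> 0) \<le> L * norm d" using z(3) by simp
  then show False using \<rho>_rad[OF ray_domain] small by simp
qed

text \<open>With k = \<kappa> |q - p|^2, the function \<rho> - (k / 2) s^2 is convex along the
  segment. At s = 1/2 the correction costs k / 8, while averaging the endpoints saves k / 4.\<close>

lemma midpoint_bound:
  assumes p: "p \<in> D" and q: "q \<in> D"
    and \<kappa>: "\<And>z v. z \<in> closed_segment p q \<Longrightarrow> \<kappa> * (norm v)\<^sup>2 \<le> \<rho>'' z v v"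
  shows "\<rho> (midpoint p q) < - \<kappa> / 8 * (norm (q - p))\<^sup>2"
proof -
  let ?v = "q - p" and ?k = "\<kappa> * (norm (q - p))\<^sup>2"
  define g where "g s = \<rho> (p + s *\<^sub>R ?v) - ?k / 2 * s\<^sup>2" for s
  have seg: "p + s *\<^sub>R ?v \<in> closed_segment p q" if "s \<in> {0..1}" for s
    using that by (auto simp: in_segment algebra_simps intro!: exI[of _ s])
  have W: "p + s *\<^sub>R ?v \<in> W" if "s \<in> {0..1}" for s
    using seg[OF that] convex_contains_segment[THEN iffD1, OF convex_D] p q D_iff by blast
  have "convex_on {0..1} g"
  proof (rule f''_ge0_imp_convex)
    fix s :: real assume s: "s \<in> {0..1}"
    show "(g has_real_derivative \<rho>' (p + s *\<^sub>R ?v) ?v - ?k * s) (at s)"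
      unfolding g_def by (rule derivative_eq_intros line_derivatives(1)[OF W[OF s]] refl | simp)+
    show "((\<lambda>s. \<rho>' (p + s *\<^sub>R ?v) ?v - ?k * s) has_real_derivative \<rho>'' (p + s *\<^sub>R ?v) ?v ?v - ?k) (at s)"
      by (rule derivative_eq_intros line_derivatives(2)[OF W[OF s]] refl | simp)+
    show "0 \<le> \<rho>'' (p + s *\<^sub>R ?v) ?v ?v - ?k"
      using \<kappa>[OF seg[OF s], of ?v] by simp
  qed simp
  then have "g ((1 - 1/2) *\<^sub>R 0 + (1/2) *\<^sub>R 1) \<le> (1 - 1/2) * g 0 + 1/2 * g 1"
    by (rule convex_onD) auto
  moreover have "p + (1/2) *\<^sub>R ?v = midpoint p q"
    by (simp add: midpoint_def algebra_simps scaleR_half_double flip: scaleR_add_left)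
  ultimately have "\<rho> (midpoint p q) \<le> (\<rho> p + \<rho> q) / 2 - ?k / 8"
    by (simp add: g_def power2_eq_square field_simps)
  moreover have "\<rho> p < 0" "\<rho> q < 0" using p q D_iff by auto
  then have "(\<rho> p + \<rho> q) / 2 < 0" by simp
  then have "(\<rho> p + \<rho> q) / 2 - ?k / 8 < 0 - ?k / 8" by (rule diff_strict_right_mono)
  ultimately have "\<rho> (midpoint p q) < 0 - ?k / 8" by (meson le_less_trans)
  then show ?thesis by simp
qed

text \<open>The part of \<open>D\<close> over a small closed ball is bounded, and its closure is
  compact. As the closed ball stays inside \<open>U\<close>, this closure lies in \<open>W\<close>,
  where the derivatives are continuous and the Hessian is positive.\<close>

lemma local_constants:
  assumes "t0 \<in> U"
  obtains e \<kappa> L R where "0 < e" "0 < \<kappa>" "cball t0 e \<subseteq> U"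
    "\<forall>t x v. t \<in> cball t0 e \<longrightarrow> (t, x) \<in> D \<longrightarrow> \<kappa> * (norm v)\<^sup>2 \<le> \<rho>'' (t, x) v v"
    "\<forall>t x. t \<in> cball t0 e \<longrightarrow> (t, x) \<in> D \<longrightarrow> norm (\<rho>' (t, x)) \<le> L"
    "\<forall>t x. t \<in> cball t0 e \<longrightarrow> (t, x) \<in> D \<longrightarrow> norm x \<le> R"
proof -
  obtain c where c: "(t0, c) \<in> D" using assms fst_D by force
  interpret strict_family_centre U D W \<rho> \<rho>' \<rho>'' c ..
  obtain e R where e: "0 < e" "\<And>t. t \<in> cball t0 e \<Longrightarrow> (t, c) \<in> D"
    "\<And>t x. t \<in> cball t0 e \<Longrightarrow> (t, c + x) \<in> D \<Longrightarrow> norm x \<le> R"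
    using fibre_local_bound[OF c] by blast
  have eU: "cball t0 e \<subseteq> U" using e(2) D_imp_U by blast
  have bd: "norm x \<le> R + norm c" if "t \<in> cball t0 e" "(t, x) \<in> D" for t x
    using e(3)[OF that(1), of "x - c"] that(2) norm_triangle_ineq[of "x - c" c] by simp
  define M where "M = D \<inter> (cball t0 e \<times> UNIV)"
  define C where "C = closure M"
  have "M \<subseteq> cball t0 e \<times> cball 0 (R + norm c)"
    using bd by (auto simp: M_def)
  then have "bounded M"
    using bounded_Times[OF bounded_cball bounded_cball] bounded_subset by blast
  then have C: "compact C" unfolding C_def by simp
  have "C \<subseteq> closure D" unfolding C_def M_def by (intro closure_mono) blast
  moreover have "C \<subseteq> cball t0 e \<times> UNIV"
    unfolding C_def M_def by (intro closure_minimal closed_Times) auto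
  ultimately have CW: "C \<subseteq> W" using closure_D eU by force
  have MC: "M \<subseteq> C" unfolding C_def by (rule closure_subset)
  have "(t0, c) \<in> M" using c e(1) by (simp add: M_def)
  then have C_ne: "C \<noteq> {}" using MC by blast
  have "compact (\<rho>' ` C)"
    by (rule compact_continuous_image[OF continuous_on_subset[OF cont_\<rho>' CW] C])
  then have "bounded (\<rho>' ` C)" by (rule compact_imp_bounded)
  then obtain L where L: "\<And>p. p \<in> C \<Longrightarrow> norm (\<rho>' p) \<le> L"
    unfolding bounded_iff by blast
  let ?S = "sphere 0 1 :: ('a \<times> 'b) set"
  \<comment> \<open>The least value of the Hessian form on unit vectors over \<open>C\<close> is the
    constant \<open>\<kappa>\<close>; homogeneity extends the bound to all vectors.\<close>
  have "\<exists>x\<in>C \<times> ?S. \<forall>y\<in>C \<times> ?S. \<rho>'' (fst x) (snd x) (snd x) \<le> \<rho>'' (fst y) (snd y) (snd y)"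
  proof (rule continuous_attains_inf)
    show "compact (C \<times> ?S)" using C by (intro compact_Times) auto
    show "C \<times> ?S \<noteq> {}"
      using C_ne norm_some_Basis[where 'a = "'a \<times> 'b"] by auto
    have "continuous_on (C \<times> ?S) (\<lambda>x. \<rho>'' (fst x))"
      using CW by (intro continuous_on_compose2[OF cont_\<rho>'' continuous_on_fst[OF continuous_on_id]]) auto
    then show "continuous_on (C \<times> ?S) (\<lambda>x. \<rho>'' (fst x) (snd x) (snd x))"
      by (intro continuous_intros)
  qed
  then obtain p0 u0 where pu: "p0 \<in> C" "u0 \<in> ?S"
    "\<And>p u. p \<in> C \<Longrightarrow> u \<in> ?S \<Longrightarrow> \<rho>'' p0 u0 u0 \<le> \<rho>'' p u u"
    by auto
  define \<kappa> where "\<kappa> = \<rho>'' p0 u0 u0"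
  have "0 < \<kappa>" unfolding \<kappa>_def using pu CW by (intro hess_pos) auto
  have \<kappa>: "\<kappa> * (norm v)\<^sup>2 \<le> \<rho>'' p v v" if "p \<in> C" for p v
  proof (cases "v = 0")
    case False
    define u where "u = (1 / norm v) *\<^sub>R v"
    have u: "u \<in> ?S" "v = norm v *\<^sub>R u" using False by (auto simp: u_def)
    have "\<rho>'' p v v = (norm v)\<^sup>2 * \<rho>'' p u u"
    proof -
      have "\<rho>'' p v v = \<rho>'' p (norm v *\<^sub>R u) (norm v *\<^sub>R u)"
        by (simp only: u(2)[symmetric])
      then show ?thesis
        by (simp add: blinfun.scaleR_left blinfun.scaleR_right power2_eq_square)
    qed
    then show ?thesis
      using pu(3)[OF that u(1)] by (simp add: \<kappa>_def mult.commute mult_right_mono)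
  qed simp
  show thesis
  proof (rule that[OF e(1) \<open>0 < \<kappa>\<close> eU])
    have M: "(t, x) \<in> C" if "t \<in> cball t0 e" "(t, x) \<in> D" for t x
      using that MC by (auto simp: M_def)
    show "\<forall>t x v. t \<in> cball t0 e \<longrightarrow> (t, x) \<in> D \<longrightarrow> \<kappa> * (norm v)\<^sup>2 \<le> \<rho>'' (t, x) v v"
      using \<kappa> M by blast
    show "\<forall>t x. t \<in> cball t0 e \<longrightarrow> (t, x) \<in> D \<longrightarrow> norm (\<rho>' (t, x)) \<le> L"
      using L M by blast
    show "\<forall>t x. t \<in> cball t0 e \<longrightarrow> (t, x) \<in> D \<longrightarrow> norm x \<le> R + norm c"
      using bd by blast
  qed
qed

lemma measure_fibre_pos:
  assumes "t \<in> U"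
  shows "0 < measure lebesgue (fibre D t)"
proof -
  obtain x where "x \<in> fibre D t" using assms fst_D by (force simp: fibre_def)
  then have "\<not> negligible (fibre D t)"
    using open_not_negligible[OF open_fibre] by blast
  then show ?thesis
    using negligible_iff_measure0[OF lmeasurable_fibre[OF assms]] zero_less_measure_iff by blast
qed

lemma measure_fibre_midpoint:
  assumes "t0 \<in> U" "v \<noteq> 0"
  obtains \<delta> where "0 < \<delta>" "\<forall>\<^sub>F h in at_right 0. t0 + h *\<^sub>R v \<in> U \<and> t0 - h *\<^sub>R v \<in> U \<and>
    (1 + \<delta> * h\<^sup>2) * sqrt (measure lebesgue (fibre D (t0 + h *\<^sub>R v)) * measure lebesgue (fibre D (t0 - h *\<^sub>R v)))
      \<le> measure lebesgue (fibre D t0)"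
proof -
  obtain e \<kappa> L R where e: "0 < e" "0 < \<kappa>" "cball t0 e \<subseteq> U"
    and \<kappa>: "\<forall>t x v. t \<in> cball t0 e \<longrightarrow> (t, x) \<in> D \<longrightarrow> \<kappa> * (norm v)\<^sup>2 \<le> \<rho>'' (t, x) v v"
    and L: "\<forall>t x. t \<in> cball t0 e \<longrightarrow> (t, x) \<in> D \<longrightarrow> norm (\<rho>' (t, x)) \<le> L"
    and R: "\<forall>t x. t \<in> cball t0 e \<longrightarrow> (t, x) \<in> D \<longrightarrow> norm x \<le> R"
    by (rule local_constants[OF assms(1)])
  obtain c where "(t0, c) \<in> D" using assms(1) fst_D by force
  then have "0 \<le> L" "0 \<le> R"
    using L R e(1) norm_ge_zero order_trans by (metis centre_in_cball less_imp_le)+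
  \<comment> \<open>Chosen so that \<delta> L R \<le> \<kappa> |v|^2 / 2, the depth of the midpoint
    per h^2. The added ones keep the denominator positive when \<open>L\<close> or \<open>R\<close>
    is 0.\<close>
  define \<delta> where "\<delta> = \<kappa> * (norm v)\<^sup>2 / (2 * ((L + 1) * (R + 1)))"
  have den: "0 < 2 * ((L + 1) * (R + 1))" using \<open>0 \<le> L\<close> \<open>0 \<le> R\<close> by simp
  then have \<delta>: "0 < \<delta>" using e(2) assms(2) by (simp add: \<delta>_def)
  have "L * R \<le> (L + 1) * (R + 1)" using \<open>0 \<le> L\<close> \<open>0 \<le> R\<close> by (intro mult_mono) auto
  then have "\<delta> * (L * R) \<le> \<delta> * ((L + 1) * (R + 1))" using \<delta> by (intro mult_left_mono) auto
  also have "\<dots> = \<kappa> * (norm v)\<^sup>2 / 2"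
  proof -
    have "a / (2 * b) * b = a / 2" if "0 < 2 * b" for a b :: real using that by simp
    from this[OF den] show ?thesis unfolding \<delta>_def .
  qed
  finally have \<delta>LR: "\<delta> * (L * R) \<le> \<kappa> * (norm v)\<^sup>2 / 2" .
  show thesis
  proof (rule that[OF \<delta>])
    have "\<forall>\<^sub>F h in at_right 0. 0 < h \<and> h < e / norm v"
      using eventually_at_right_real[of 0 "e / norm v"] e(1) assms(2) by simp
    then show "\<forall>\<^sub>F h in at_right 0. t0 + h *\<^sub>R v \<in> U \<and> t0 - h *\<^sub>R v \<in> U \<and>
      (1 + \<delta> * h\<^sup>2) * sqrt (measure lebesgue (fibre D (t0 + h *\<^sub>R v)) * measure lebesgue (fibre D (t0 - h *\<^sub>R v)))
      \<le> measure lebesgue (fibre D t0)"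
    proof eventually_elim
      case (elim h)
      let ?p = "t0 + h *\<^sub>R v" and ?m = "t0 - h *\<^sub>R v" and ?s = "1 + \<delta> * h\<^sup>2"
      let ?A = "midpoints (fibre D ?p) (fibre D ?m)"
      have "h * norm v \<le> e" using elim assms(2) by (simp add: field_simps)
      then have ball: "?p \<in> cball t0 e" "?m \<in> cball t0 e" "t0 \<in> cball t0 e"
        using elim e(1) by (auto simp: dist_norm)
      then have U: "?p \<in> U" "?m \<in> U" using e(3) by auto
      \<comment> \<open>The dilation is about the origin, wherever the fibre lies: it displaces
        \<open>x\<close> by at most \<delta> h^2 R, and only the size of the displacement
        matters.\<close>
      have mid: "?s *\<^sub>R x \<in> fibre D t0" if x: "x \<in> ?A" for x
      proof -
        obtain y z where yz: "(?p, y) \<in> D" "(?m, z) \<in> D" "x = midpoint y z"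
          using x by (auto simp: midpoints_def fibre_def)
        have mp: "midpoint (?p, y) (?m, z) = (t0, x)"
          using yz(3) by (simp add: midpoint_def algebra_simps flip: scaleR_add_left)
        have xD: "(t0, x) \<in> D"
          using convex_D yz mp midpoint_in_closed_segment[of "(?p, y)" "(?m, z)"]
          by (metis convex_contains_segment subsetD)
        have lt: "\<rho> (t0, x) < - \<kappa> / 8 * (norm ((?m, z) - (?p, y)))\<^sup>2"
          unfolding mp[symmetric]
        proof (rule midpoint_bound[OF yz(1,2)])
          fix w u assume "w \<in> closed_segment (?p, y) (?m, z)"
          moreover have "convex (D \<inter> cball t0 e \<times> UNIV)"
            by (intro convex_Int convex_D convex_Times convex_cball convex_UNIV)
          then have "closed_segment (?p, y) (?m, z) \<subseteq> D \<inter> cball t0 e \<times> UNIV"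
            using yz(1,2) ball by (intro closed_segment_subset) auto
          ultimately have "w \<in> D \<inter> cball t0 e \<times> UNIV" by blast
          then show "\<kappa> * (norm u)\<^sup>2 \<le> \<rho>'' w u u" 
            using \<kappa>[rule_format, of "fst w" "snd w" u] by auto
        qed
        \<comment> \<open>The base components alone are 2 h |v| apart, whatever the fibre components
          are; hence the depth \<kappa> / 8 times 4 h^2 |v|^2.\<close>
        have "(2 * h * norm v)\<^sup>2 \<le> (norm ((?m, z) - (?p, y)))\<^sup>2"
        proof (rule power_mono)
          have "norm (?m - ?p) = 2 * h * norm v"
          proof -
            have "?m - ?p = (- 2 * h) *\<^sub>R v" by (simp add: algebra_simps flip: scaleR_add_left)
            then show ?thesis using elim by (simp del: scaleR_minus_left)
          qed
          then show "2 * h * norm v \<le> norm ((?m, z) - (?p, y))"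
            using norm_fst_le[of "?m - ?p" "z - y"] by simp
        qed (use elim in simp)
        then have "\<kappa> / 8 * (2 * h * norm v)\<^sup>2 \<le> \<kappa> / 8 * (norm ((?m, z) - (?p, y)))\<^sup>2"
          using e(2) by (intro mult_left_mono) auto
        then have le: "- \<kappa> / 8 * (norm ((?m, z) - (?p, y)))\<^sup>2 \<le> - (\<kappa> / 8 * (2 * h * norm v)\<^sup>2)"
          unfolding minus_divide_left[symmetric] mult_minus_left neg_le_iff_le .
        have "\<kappa> / 8 * (2 * h * norm v)\<^sup>2 = \<kappa> * (norm v)\<^sup>2 / 2 * h\<^sup>2"
          by (simp add: power_mult_distrib)
        with less_le_trans[OF lt le] have "\<rho> (t0, x) < - (\<kappa> * (norm v)\<^sup>2 / 2 * h\<^sup>2)"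
          by (simp only:)
        moreover have "L * norm ((\<delta> * h\<^sup>2) *\<^sub>R x) \<le> \<kappa> * (norm v)\<^sup>2 / 2 * h\<^sup>2"
        proof -
          have "norm x \<le> R" using R ball(3) xD by blast
          then have "L * norm ((\<delta> * h\<^sup>2) *\<^sub>R x) \<le> L * (\<delta> * h\<^sup>2 * R)"
            using \<delta> \<open>0 \<le> L\<close> by (auto intro!: mult_left_mono)
          also have "\<dots> = \<delta> * (L * R) * h\<^sup>2" by simp
          also have "\<dots> \<le> \<kappa> * (norm v)\<^sup>2 / 2 * h\<^sup>2" using \<delta>LR by (intro mult_right_mono) auto
          finally show ?thesis .
        qed
        ultimately have "\<rho> (t0, x) + L * norm ((\<delta> * h\<^sup>2) *\<^sub>R x) < 0" by linarith
        then have "(t0, x + (\<delta> * h\<^sup>2) *\<^sub>R x) \<in> D"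
          using L ball(3) by (intro exit_bound[OF xD]) auto
        then show ?thesis by (simp add: fibre_def scaleR_add_left)
      qed
      have A: "?A \<in> lmeasurable"
        by (intro lmeasurable_midpoints open_fibre bounded_fibre U)
      have s: "1 \<le> ?s" using \<delta> by simp
      have "?s * sqrt (measure lebesgue (fibre D ?p) * measure lebesgue (fibre D ?m)) \<le> ?s * measure lebesgue ?A"
        using s by (intro mult_left_mono brunn_minkowski_midpoints open_fibre bounded_fibre U) auto
      \<comment> \<open>Dilation multiplies volume by the full power of \<open>?s\<close>; as
        \<open>?s\<close> is at least 1 and the dimension is positive, the first power is a
        sufficient lower bound.\<close>
      also have "\<dots> \<le> ?s ^ DIM('b) * measure lebesgue ?A"
        using s power_increasing[of 1 "DIM('b)" ?s] by (intro mult_right_mono) (auto simp: Suc_le_eq)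
      also have "\<dots> = measure lebesgue ((\<lambda>x. ?s *\<^sub>R x + 0) ` ?A)"
        using measure_lebesgue_affine[of ?s 0 ?A] s by simp
      also have "\<dots> \<le> measure lebesgue (fibre D t0)"
      proof (rule measure_mono_fmeasurable)
        show "(\<lambda>x. ?s *\<^sub>R x + 0) ` ?A \<subseteq> fibre D t0" using mid by auto
        have "open ((*\<^sub>R) ?s ` ?A)"
          using s by (intro open_scaling open_midpoints open_fibre) simp
        then show "(\<lambda>x. ?s *\<^sub>R x + 0) ` ?A \<in> sets lebesgue" by simp
      qed (rule lmeasurable_fibre[OF assms(1)])
      finally show ?case using U by blast
    qed
  qed
qed

end

context strict_family
begin

lemma second_difference_bound:
  assumes "t \<in> U" "v \<noteq> 0"
  defines "f \<equiv> \<lambda>t. - ln (measure lebesgue (fibre D t))"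
  obtains \<delta> where "0 < \<delta>"
    "\<forall>\<^sub>F h in at_right 0. \<delta> * h\<^sup>2 \<le> f (t + h *\<^sub>R v) + f (t - h *\<^sub>R v) - 2 * f t"
proof -
  let ?V = "\<lambda>t. measure lebesgue (fibre D t)"
  obtain \<delta> where \<delta>: "0 < \<delta>" and ev: "\<forall>\<^sub>F h in at_right 0. t + h *\<^sub>R v \<in> U \<and> t - h *\<^sub>R v \<in> U \<and>
    (1 + \<delta> * h\<^sup>2) * sqrt (?V (t + h *\<^sub>R v) * ?V (t - h *\<^sub>R v)) \<le> ?V t"
    by (rule measure_fibre_midpoint[OF assms(1,2)])
  have "((\<lambda>h. \<delta> * h\<^sup>2) \<longlongrightarrow> \<delta> * 0\<^sup>2) (at_right 0)"
    by (intro tendsto_intros)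
  \<comment> \<open>For 0 \<le> x \<le> 1/2 the bound ln (1 + x) \<ge> x - x^2 gives 2 ln (1 + x)
    \<ge> x. The factor 2 comes from the square root, so \<open>\<delta>\<close> itself carries over
    to the second difference.\<close>
  then have "\<forall>\<^sub>F h in at_right 0. \<delta> * h\<^sup>2 < 1 / 2"
    by (rule order_tendstoD) simp
  with ev have "\<forall>\<^sub>F h in at_right 0. \<delta> * h\<^sup>2 \<le> f (t + h *\<^sub>R v) + f (t - h *\<^sub>R v) - 2 * f t"
  proof eventually_elim
    case (elim h)
    let ?x = "\<delta> * h\<^sup>2" and ?p = "?V (t + h *\<^sub>R v)" and ?m = "?V (t - h *\<^sub>R v)"
    have x: "0 \<le> ?x" "?x \<le> 1 / 2" using \<delta> elim by simp_all
    have pos: "0 < ?p" "0 < ?m" using elim measure_fibre_pos by blast+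
    have "?x * ?x \<le> ?x * (1 / 2)" using x by (intro mult_left_mono)
    moreover have "?x - ?x\<^sup>2 \<le> ln (1 + ?x)"
      using x by (intro ln_one_plus_pos_lower_bound) auto
    ultimately have 1: "?x \<le> 2 * ln (1 + ?x)"
      by (simp add: power2_eq_square)
    have s: "0 < sqrt (?p * ?m)" using pos by simp
    have "ln ((1 + ?x) * sqrt (?p * ?m)) \<le> ln (?V t)"
      using elim x s by (intro ln_mono mult_pos_pos) auto
    moreover have "ln ((1 + ?x) * sqrt (?p * ?m)) = ln (1 + ?x) + ln (sqrt (?p * ?m))"
      using x s by (intro ln_mult_pos) auto
    moreover have "ln (sqrt (?p * ?m)) = (ln ?p + ln ?m) / 2"
      using pos by (simp add: ln_sqrt ln_mult_pos)
    ultimately show ?case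
      using 1 unfolding f_def by argo
  qed
  then show thesis using that \<delta> by blast
qed

lemma C2_strictly_convex_volume:
  "C2_strictly_convex_on U (\<lambda>t. - ln (measure lebesgue (fibre D t)))"
  unfolding C2_strictly_convex_on_def
proof (intro conjI ballI allI impI)
  let ?f = "\<lambda>t. - ln (measure lebesgue (fibre D t))"
  show C2: "C2_on U ?f"
    using C2_measure_fibre measure_fibre_pos by (rule C2_on_neg_ln)
  fix t and v :: 'a
  assume t: "t \<in> U" and v: "v \<noteq> 0"
  obtain f' f'' where f0: "\<forall>t\<in>U. (?f has_derivative blinfun_apply (f' t)) (at t)"
    "\<forall>t\<in>U. (f' has_derivative blinfun_apply (f'' t)) (at t)" "continuous_on U f''"
    by (rule C2_onE[OF C2])
  note f = f0[rule_format]
  obtain \<delta> where \<delta>: "0 < \<delta>"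
    "\<forall>\<^sub>F h in at_right 0. \<delta> * h\<^sup>2 \<le> ?f (t + h *\<^sub>R v) + ?f (t - h *\<^sub>R v) - 2 * ?f t"
    by (rule second_difference_bound[OF t v])
  have "0 < f'' t v v"
    by (rule second_derivative_pos[OF open_U t _ f(2)[OF t] \<delta>]) (rule f(1))
  then show "0 < hessian ?f t v v"
    using hessian_eq[OF open_U t f(1) f(2)[OF t]] by simp
qed

end

theorem corollary1p8:
  fixes U :: "(real ^ 'n) set" and D :: "((real ^ 'n) \<times> (real ^ 'm)) set"
  assumes "is_domain U"
    and "strictly_convex_family U D"
    and "\<forall>t\<in>U. bounded (fibre D t)"
  shows "C2_strictly_convex_on U (\<lambda>t. - ln (measure lebesgue (fibre D t)))"
proof -
  have D: "open D" "convex D" "fst ` D = U"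
    using assms(2) by (auto simp: strictly_convex_family_def is_domain_def)
  obtain W \<rho> where W: "open W" "closure D \<inter> (U \<times> UNIV) \<subseteq> W"
    "C2_strictly_convex_on W \<rho>" "D = {p \<in> W. \<rho> p < 0}"
    using assms(2) unfolding strictly_convex_family_def by blast
  then have C2: "C2_on W \<rho>" and hess: "\<And>p v. p \<in> W \<Longrightarrow> v \<noteq> 0 \<Longrightarrow> hessian \<rho> p v v > 0"
    by (auto simp: C2_strictly_convex_on_def)
  obtain \<rho>' \<rho>'' where \<rho>0: "\<forall>p\<in>W. (\<rho> has_derivative blinfun_apply (\<rho>' p)) (at p)"
    "\<forall>p\<in>W. (\<rho>' has_derivative blinfun_apply (\<rho>'' p)) (at p)" "continuous_on W \<rho>''"
    by (rule C2_onE[OF C2])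
  note \<rho> = \<rho>0[rule_format]
  interpret strict_family U D W \<rho> \<rho>' \<rho>''
  proof
    show "\<rho>'' p v v > 0" if "p \<in> W" "v \<noteq> 0" for p v
      using hess[OF that] hessian_eq[OF W(1) that(1) \<rho>(1) \<rho>(2)[OF that(1)]] by simp
    show "(t, x) \<in> W" if "(t, x) \<in> closure D" "t \<in> U" for t x
      using W(2) that by blast
    show "bounded (fibre D t)" if "t \<in> U" for t
      using assms(3) that by blast
  qed (fact D W(1,4) \<rho>)+
  show ?thesis by (rule C2_strictly_convex_volume)
qed

end
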